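(* There are absolute constants $C_0,C_1>0$ such that the following holds. Let $(X,\Pi)$ be a two-sided $\gamma$-local-spectral expander with $\gamma\le2^{-C_0k}$ and let $f\in C_k$ have HD-level-set decomposition $f=f_0+\cdots+f_k$. If $f$ is $(\varepsilon_1,\dots,\varepsilon_\ell)$-$\ell_\infty$-pseudorandom, then for all $1\le i\le\ell$, \[|\langle f,f_i\rangle|\le\Big(\binom{k}{i}+c(k)\gamma\Big)\varepsilon_i^2+c(k)\gamma\|f\|^2,\] where $c(k)\le 2^{C_1k}$; and if moreover $f$ has $i$-local constant sign, then \[|\langle f,f_i\rangle|\le\binom{k}{i}\varepsilon_i|\mathbb E[f]|+c(k)\gamma\|f\|^2.\]
   Context: Weighted pure simplicial complex $(X,\Pi)$ of dimension $d$: $X(d)\subseteq\binom{[n]}{d}$, $X(i)$ the $i$-subsets of members of $X(d)$, $\Pi_d=\Pi$ a distribution on $X(d)$, $\Pi_i(x)=\frac1{i+1}\sum_{y\in X(i+1),y\supset x}\Pi_{i+1}(y)$. Link of $s\in X(i)$: $X_s=\{t\setminus s:t\in X,t\supseteq s\}$ with induced distribution; for functions on level $k$, $X_s$ also denotes the set of $k$-faces containing $s$, and $\mathbb E_{X_s}[f]$ the $\Pi_k$-weighted average of $f$ over them. Two-sided $\gamma$-local-spectral expander: for all $0\le i\le d-2$, $s\in X(i)$, the weighted graph on the $1$-faces of $X_s$ with edges the $2$-faces of $X_s$ has all nontrivial random-walk eigenvalues of absolute value $\le\gamma$. $C_k$: functions $X(k)\to\mathbb R$ with $\langle f,g\rangle=\mathbb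 E_{\Pi_k}[fg]$, $\|f\|^2=\langle f,f\rangle$, $\mathbb E[f]=\mathbb E_{\Pi_k}[f]$. $U_kf(y)=\frac1{k+1}\sum_{x\subset y}f(x)$; $D_{k+1}f(x)=\frac1{k+1}\sum_{y\supset x}\frac{\Pi_{k+1}(y)}{\Pi_k(x)}f(y)$; $U^k_\ell=U_{k-1}\cdots U_\ell$, $D^k_\ell=D_{\ell+1}\cdots D_k$ (so $D^k_if(s)=\mathbb E_{X_s}[f]$). $H^0=C_0$, $H^\ell=\mathrm{Ker}(D_\ell)$ for $\ell\ge1$, $V_k^\ell=U^k_\ell H^\ell$; $f=\sum f_\ell$ with $f_\ell\in V_k^\ell$ is the HD-level-set decomposition. $f$ is $(\varepsilon_1,\dots,\varepsilon_\ell)$-$\ell_\infty$-pseudorandom if $\|D^k_if-\mathbb E[f]\|_\infty\le\varepsilon_i$ for all $1\le i\le\ell$. $f$ has $i$-local constant sign if $\mathbb E[f]\ne0$ and for every $s\in X(i)$ with $\mathbb E_{X_s}[f]\neq0$, $\mathrm{sign}(\mathbb E_{X_s}[f])=\mathrm{sign}(\mathbb E[f])$. *)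

theory Defs
  imports Complex_Main
begin

text \<open>
  The index of a level is the cardinality of its faces, so a complex of dimension \<open>d\<close> has
  facets with \<open>d\<close> elements and its vertices form level \<open>1\<close>.
  A function on level \<open>k\<close> is a total function \<open>nat set \<Rightarrow> real\<close>; only its values on the
  \<open>k\<close>-faces matter, and equality of such functions always means equality on the \<open>k\<close>-faces.
\<close>

record wcomplex =
  cdim :: nat
  facets :: "nat set set"
  facet_wt :: "nat set \<Rightarrow> real"

text \<open>
  The distribution on the facets has full support: the operators divide by the weights of
  faces, and the weighted pairing on level \<open>k\<close> is to be an inner product.
\<close>

definition weighted_pure_complex :: "nat \<Rightarrow> wcomplex \<Rightarrow> bool" where
  "weighted_pure_complex n X \<longleftrightarrow>
     facets X \<subseteq> {t. t \<subseteq> {1..n} \<and> card t = cdim X} \<and>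
     (\<forall>t\<in>facets X. facet_wt X t > 0) \<and>
     (\<Sum>t\<in>facets X. facet_wt X t) = 1"

definition faces :: "wcomplex \<Rightarrow> nat \<Rightarrow> nat set set" where
  "faces X i = {s. card s = i \<and> (\<exists>t\<in>facets X. s \<subseteq> t)}"

function level_wt :: "wcomplex \<Rightarrow> nat \<Rightarrow> nat set \<Rightarrow> real" where
  "level_wt X i x =
     (if i < cdim X
      then 1 / real (i + 1) * (\<Sum>y\<in>{y \<in> faces X (i + 1). x \<subset> y}. level_wt X (i + 1) y)
      else facet_wt X x)"
  by pat_completeness auto
termination
  by (relation "measure (\<lambda>(X, i, x). cdim X - i)") auto

declare level_wt.simps [simp del]


subsection \<open>Links and local spectral expansion\<close>

definition link :: "wcomplex \<Rightarrow> nat set \<Rightarrow> wcomplex" where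
  "link X s =
     \<lparr> cdim = cdim X - card s,
       facets = {t - s | t. t \<in> facets X \<and> s \<subseteq> t},
       facet_wt = (\<lambda>t. facet_wt X (s \<union> t) / (\<Sum>y\<in>{y \<in> facets X. s \<subseteq> y}. facet_wt X y)) \<rparr>"

text \<open>
  One step of the random walk on the weighted graph with the 1-faces as vertices and the
  2-faces as edges: the vertex \<open>x\<close> moves along an incident edge, chosen with probability
  proportional to its weight.
\<close>

definition walk :: "wcomplex \<Rightarrow> (nat set \<Rightarrow> real) \<Rightarrow> nat set \<Rightarrow> real" where
  "walk X g x =
     (\<Sum>y\<in>{y \<in> faces X 1. x \<union> y \<in> faces X 2}.
        level_wt X 2 (x \<union> y) / (\<Sum>e\<in>{e \<in> faces X 2. x \<subset> e}. level_wt X 2 e) * g y)"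

text \<open>
  The trivial eigenvalue is one copy of \<open>1\<close>, belonging to the constant functions.
  An eigenvalue is nontrivial iff it has a non-constant eigenfunction; in particular \<open>1\<close> is
  nontrivial exactly if its multiplicity is at least two.  The walk is reversible, so all its
  eigenvalues are real and it suffices to consider real eigenfunctions.
\<close>

definition nontrivial_eigenvalue :: "wcomplex \<Rightarrow> real \<Rightarrow> bool" where
  "nontrivial_eigenvalue X \<mu> \<longleftrightarrow>
     (\<exists>g. (\<forall>x\<in>faces X 1. walk X g x = \<mu> * g x) \<and> \<not> (\<exists>a. \<forall>x\<in>faces X 1. g x = a))"

text \<open>
  The condition \<open>0 \<le> \<gamma>\<close> follows from the eigenvalue condition if \<open>cdim X \<ge> 2\<close>; it only
  excludes negative parameters in the case \<open>cdim X \<le> 1\<close>, where there are no links to consider.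
\<close>

definition two_sided_local_expander :: "wcomplex \<Rightarrow> real \<Rightarrow> bool" where
  "two_sided_local_expander X \<gamma> \<longleftrightarrow>
     0 \<le> \<gamma> \<and>
     (\<forall>i s. i + 2 \<le> cdim X \<longrightarrow> s \<in> faces X i \<longrightarrow>
        (\<forall>\<mu>. nontrivial_eigenvalue (link X s) \<mu> \<longrightarrow> \<bar>\<mu>\<bar> \<le> \<gamma>))"


subsection \<open>Functions on a level\<close>

definition expect :: "wcomplex \<Rightarrow> nat \<Rightarrow> (nat set \<Rightarrow> real) \<Rightarrow> real" where
  "expect X k f = (\<Sum>x\<in>faces X k. level_wt X k x * f x)"

definition inner_lev :: "wcomplex \<Rightarrow> nat \<Rightarrow> (nat set \<Rightarrow> real) \<Rightarrow> (nat set \<Rightarrow> real) \<Rightarrow> real" where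
  "inner_lev X k f g = expect X k (\<lambda>x. f x * g x)"

definition norm_lev :: "wcomplex \<Rightarrow> nat \<Rightarrow> (nat set \<Rightarrow> real) \<Rightarrow> real" where
  "norm_lev X k f = sqrt (inner_lev X k f f)"

definition linf_norm :: "wcomplex \<Rightarrow> nat \<Rightarrow> (nat set \<Rightarrow> real) \<Rightarrow> real" where
  "linf_norm X k f = Max ((\<lambda>x. \<bar>f x\<bar>) ` faces X k)"

definition local_expect :: "wcomplex \<Rightarrow> nat \<Rightarrow> nat set \<Rightarrow> (nat set \<Rightarrow> real) \<Rightarrow> real" where
  "local_expect X k s f =
     (\<Sum>y\<in>{y \<in> faces X k. s \<subseteq> y}. level_wt X k y * f y) /
     (\<Sum>y\<in>{y \<in> faces X k. s \<subseteq> y}. level_wt X k y)"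


subsection \<open>Averaging operators and the level-set decomposition\<close>

definition up :: "wcomplex \<Rightarrow> nat \<Rightarrow> (nat set \<Rightarrow> real) \<Rightarrow> nat set \<Rightarrow> real" where
  "up X k f y = 1 / real (k + 1) * (\<Sum>x\<in>{x \<in> faces X k. x \<subset> y}. f x)"

text \<open>\<open>down X k\<close> maps level \<open>k\<close> to level \<open>k - 1\<close>, for \<open>k \<ge> 1\<close>.\<close>

definition down :: "wcomplex \<Rightarrow> nat \<Rightarrow> (nat set \<Rightarrow> real) \<Rightarrow> nat set \<Rightarrow> real" where
  "down X k f x =
     1 / real k * (\<Sum>y\<in>{y \<in> faces X k. x \<subset> y}. level_wt X k y / level_wt X (k - 1) x * f y)"

text \<open>
  \<open>up_iter X l k\<close> goes from level \<open>l\<close> to level \<open>k\<close>, and \<open>down_iter X l k\<close> from level \<open>k\<close> to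
  level \<open>l\<close>; both are meant for \<open>l \<le> k\<close>.
\<close>

fun up_iter :: "wcomplex \<Rightarrow> nat \<Rightarrow> nat \<Rightarrow> (nat set \<Rightarrow> real) \<Rightarrow> nat set \<Rightarrow> real" where
  "up_iter X l 0 f = f"
| "up_iter X l (Suc k) f = (if l \<le> k then up X k (up_iter X l k f) else f)"

fun down_iter :: "wcomplex \<Rightarrow> nat \<Rightarrow> nat \<Rightarrow> (nat set \<Rightarrow> real) \<Rightarrow> nat set \<Rightarrow> real" where
  "down_iter X l 0 f = f"
| "down_iter X l (Suc k) f = (if l \<le> k then down_iter X l k (down X (Suc k) f) else f)"

definition H_space :: "wcomplex \<Rightarrow> nat \<Rightarrow> (nat set \<Rightarrow> real) set" where
  "H_space X l = {h. l = 0 \<or> (\<forall>x\<in>faces X (l - 1). down X l h x = 0)}"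

definition V_space :: "wcomplex \<Rightarrow> nat \<Rightarrow> nat \<Rightarrow> (nat set \<Rightarrow> real) set" where
  "V_space X k l = {f. \<exists>h\<in>H_space X l. \<forall>y\<in>faces X k. f y = up_iter X l k h y}"

definition HD_decomposition ::
    "wcomplex \<Rightarrow> nat \<Rightarrow> (nat set \<Rightarrow> real) \<Rightarrow> (nat \<Rightarrow> nat set \<Rightarrow> real) \<Rightarrow> bool" where
  "HD_decomposition X k f fs \<longleftrightarrow>
     (\<forall>l\<le>k. fs l \<in> V_space X k l) \<and> (\<forall>y\<in>faces X k. f y = (\<Sum>l\<le>k. fs l y))"


subsection \<open>Pseudorandomness and local constant sign\<close>

definition linf_pseudorandom ::
    "wcomplex \<Rightarrow> nat \<Rightarrow> nat \<Rightarrow> (nat \<Rightarrow> real) \<Rightarrow> (nat set \<Rightarrow> real) \<Rightarrow> bool" where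
  "linf_pseudorandom X k l \<epsilon> f \<longleftrightarrow>
     (\<forall>i\<in>{1..l}. linf_norm X i (\<lambda>s. down_iter X i k f s - expect X k f) \<le> \<epsilon> i)"

definition local_constant_sign :: "wcomplex \<Rightarrow> nat \<Rightarrow> nat \<Rightarrow> (nat set \<Rightarrow> real) \<Rightarrow> bool" where
  "local_constant_sign X k i f \<longleftrightarrow>
     expect X k f \<noteq> 0 \<and>
     (\<forall>s\<in>faces X i. local_expect X k s f \<noteq> 0 \<longrightarrow>
        sgn (local_expect X k s f) = sgn (expect X k f))"

end

theory Submission
  imports Defs "HOL-Analysis.Function_Topology" "HOL-Analysis.Convex"
begin

text \<open>
  Garland's method: the inner product of two up-steps is an average over links of local walk
  inner products, so local expansion gives
  \<open>D\<^bsub>m+1\<^esub>U\<^sub>m \<approx> 1/(m+1) I + m/(m+1) U\<^bsub>m-1\<^esub>D\<^sub>m\<close> up to \<open>\<gamma>\<close> in operator norm.  Iterating on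
  \<open>h\<^sub>l \<in> Ker D\<^sub>l\<close>, the lifts \<open>f\<^sub>l = U\<^sup>k h\<^sub>l\<close> are almost orthogonal and
  \<open>\<parallel>f\<^sub>l\<parallel>\<^sup>2 \<approx> \<parallel>h\<^sub>l\<parallel>\<^sup>2 / (k choose l)\<close>; in particular \<open>\<Sum>\<^sub>l \<parallel>h\<^sub>l\<parallel>\<^sup>2 \<le> 2\<^bsup>k+1\<^esup> \<parallel>f\<parallel>\<^sup>2\<close>.

  Let \<open>g = D\<^sup>k\<^sub>i f - E[f]\<close> and \<open>s = \<langle>f, f\<^sub>i\<rangle>\<close>.  Then \<open>s = \<langle>D\<^sup>k\<^sub>i f, h\<^sub>i\<rangle> = \<langle>g, h\<^sub>i\<rangle>\<close>, hence
  \<open>s\<^sup>2 \<le> \<parallel>g\<parallel>\<^sup>2 \<parallel>h\<^sub>i\<parallel>\<^sup>2\<close>, while \<open>\<parallel>h\<^sub>i\<parallel>\<^sup>2 \<le> (k choose i) (s + e)\<close> with an error \<open>e\<close> of order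
  \<open>\<gamma> \<parallel>f\<parallel>\<^sup>2\<close>.  Together these give \<open>\<bar>s\<bar> \<le> (k choose i) \<parallel>g\<parallel>\<^sup>2 + e\<close>.  Pseudorandomness yields
  \<open>\<parallel>g\<parallel>\<^sup>2 \<le> \<epsilon>\<^sub>i\<^sup>2\<close>, and under local constant sign
  \<open>\<parallel>g\<parallel>\<^sup>2 = \<langle>D\<^sup>k\<^sub>i f, g\<rangle> \<le> \<epsilon>\<^sub>i E\<bar>D\<^sup>k\<^sub>i f\<bar> = \<epsilon>\<^sub>i \<bar>E[f]\<bar>\<close>.
\<close>

subsection \<open>Self-adjoint Markov operators\<close>

text \<open>
  The norm of the operator on the compact unit sphere of mean-zero functions is attained, at a
  function \<open>h\<close> with \<open>T\<^sup>2 h = \<mu>\<^sup>2 h\<close>; either \<open>h\<close> or \<open>T h - \<mu> h\<close> is then an eigenfunction for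
  \<open>\<plusminus>\<mu>\<close>.
\<close>

lemma mean_zero_contraction:
  fixes V :: "'a set" and w :: "'a \<Rightarrow> real" and K :: "'a \<Rightarrow> 'a \<Rightarrow> real"
  assumes fin: "finite V" and w: "\<And>x. x \<in> V \<Longrightarrow> w x > 0"
    and sym: "\<And>x y. x \<in> V \<Longrightarrow> y \<in> V \<Longrightarrow> w x * K x y = w y * K y x"
    and row: "\<And>x. x \<in> V \<Longrightarrow> (\<Sum>y\<in>V. K x y) = 1"
    and eig: "\<And>\<mu> g. \<forall>x\<in>V. (\<Sum>y\<in>V. K x y * g y) = \<mu> * g x \<Longrightarrow>
                \<not> (\<exists>a. \<forall>x\<in>V. g x = a) \<Longrightarrow> \<bar>\<mu>\<bar> \<le> \<gamma>"
    and mean: "(\<Sum>x\<in>V. w x * g x) = 0"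
  shows "(\<Sum>x\<in>V. w x * (\<Sum>y\<in>V. K x y * g y)\<^sup>2) \<le> \<gamma>\<^sup>2 * (\<Sum>x\<in>V. w x * (g x)\<^sup>2)"
proof (cases "\<forall>x\<in>V. g x = 0")
  case True
  then have "(\<Sum>y\<in>V. K x y * g y) = 0" for x by simp
  then show ?thesis using True by simp
next
  case False
  define T where "T = (\<lambda>h x. \<Sum>y\<in>V. K x y * h y)"
  define ip where "ip = (\<lambda>f h. \<Sum>x\<in>V. w x * (f x * h x))"
  define E where "E = (\<lambda>h. \<Sum>x\<in>V. w x * h x)"
  have ip_sym: "ip a b = ip b a" for a b
    unfolding ip_def by (simp add: mult.commute)
  have ip_lin: "ip (\<lambda>x. a x + t * b x) c = ip a c + t * ip b c" for a b c t
    unfolding ip_def by (simp add: algebra_simps sum.distrib sum_distrib_left)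
  have ip_lin2: "ip c (\<lambda>x. a x + t * b x) = ip c a + t * ip c b" for a b c t
    by (metis ip_lin ip_sym)
  have T_lin: "T (\<lambda>x. a x + t * b x) = (\<lambda>x. T a x + t * T b x)" for a b t
    unfolding T_def by (auto simp: algebra_simps sum.distrib sum_distrib_left)
  have E_lin: "E (\<lambda>x. a x + t * b x) = E a + t * E b" for a b t
    unfolding E_def by (simp add: algebra_simps sum.distrib sum_distrib_left)
  have T_adj: "ip (T a) b = ip a (T b)" for a b
  proof -
    have "ip (T a) b = (\<Sum>x\<in>V. \<Sum>y\<in>V. (w x * K x y) * (a y * b x))"
      unfolding ip_def T_def by (simp add: sum_distrib_left sum_distrib_right mult_ac)
    also have "\<dots> = (\<Sum>x\<in>V. \<Sum>y\<in>V. (w y * K y x) * (a y * b x))"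
      by (intro sum.cong refl) (simp add: sym)
    also have "\<dots> = (\<Sum>y\<in>V. \<Sum>x\<in>V. (w y * K y x) * (a y * b x))"
      by (rule sum.swap)
    also have "\<dots> = ip a (T b)"
      unfolding ip_def T_def by (simp add: sum_distrib_left sum_distrib_right mult_ac)
    finally show ?thesis .
  qed
  have E_T: "E (T a) = E a" for a
  proof -
    have "E (T a) = ip (T a) (\<lambda>_. 1)" by (simp add: E_def ip_def)
    also have "\<dots> = ip a (T (\<lambda>_. 1))" by (rule T_adj)
    also have "\<dots> = E a" using row by (simp add: E_def ip_def T_def)
    finally show ?thesis .
  qed
  have ip_pos: "ip a a \<ge> 0" for a
    unfolding ip_def by (intro sum_nonneg) (simp add: less_imp_le w)
  have ip_zero: "a x = 0" if "ip a a = 0" "x \<in> V" for a x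
  proof -
    have "\<forall>x\<in>V. w x * (a x * a x) = 0"
      using that(1) unfolding ip_def
      by (subst (asm) sum_nonneg_eq_0_iff) (auto simp: fin less_imp_le w)
    then show ?thesis using that(2) w by fastforce
  qed
  define B where "B = (\<lambda>x. if x \<in> V then {- sqrt (1 / w x)..sqrt (1 / w x)} else {0::real})"
  define S where "S = Pi\<^sub>E UNIV B \<inter> ({h. E h = 0} \<inter> {h. ip h h = 1})"
  have compact_box: "compact (Pi\<^sub>E UNIV B)"
  proof -
    have "compactin (product_topology (\<lambda>_::'a. euclidean) UNIV) (Pi\<^sub>E UNIV B)"
      by (subst compactin_PiE) (auto simp: B_def)
    then show ?thesis by (simp add: euclidean_product_topology)
  qed
  have cont: "continuous_on A (\<lambda>h::'a \<Rightarrow> real. h x)" for A x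
    by (rule continuous_on_subset[OF continuous_on_product_coordinates subset_UNIV])
  have "continuous_on UNIV E" unfolding E_def
    by (intro continuous_on_sum continuous_on_mult continuous_on_const cont)
  from closed_Collect_eq[OF this continuous_on_const] have "closed {h. E h = 0}" .
  moreover have "continuous_on UNIV (\<lambda>h. ip h h)" unfolding ip_def
    by (intro continuous_on_sum continuous_on_mult continuous_on_const cont)
  from closed_Collect_eq[OF this continuous_on_const] have "closed {h. ip h h = 1}" .
  ultimately have compS: "compact S"
    unfolding S_def by (intro compact_Int_closed closed_Int compact_box)
  have normalise: "\<exists>h\<in>S. \<forall>x\<in>V. h x = r * a x"
    if "E a = 0" "r\<^sup>2 * ip a a = 1" for a r
  proof -
    define h where "h = (\<lambda>x. if x \<in> V then r * a x else 0)"
    have h1: "ip h h = 1"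
      using that(2) by (simp add: ip_def h_def sum_distrib_left power2_eq_square mult_ac)
    have h2: "E h = r * E a" by (simp add: E_def h_def sum_distrib_left mult_ac)
    have bd: "\<bar>h x\<bar> \<le> sqrt (1 / w x)" if x: "x \<in> V" for x
    proof -
      have "w x * (h x * h x) \<le> ip h h"
        unfolding ip_def by (rule member_le_sum) (auto simp: fin x less_imp_le w)
      then have "(h x)\<^sup>2 \<le> 1 / w x"
        using w[OF x] h1 by (simp add: field_simps power2_eq_square)
      then show ?thesis by (simp add: real_le_rsqrt)
    qed
    have "h x \<in> B x" for x
    proof (cases "x \<in> V")
      case True
      then show ?thesis using bd[OF True] by (simp add: B_def abs_le_iff minus_le_iff)
    qed (simp add: B_def h_def)
    then have "h \<in> Pi\<^sub>E UNIV B" by auto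
    then show ?thesis using h1 h2 that(1) by (intro bexI[of _ h]) (auto simp: S_def h_def)
  qed
  have scale_exists: "\<exists>r. r\<^sup>2 * ip a a = 1" if "ip a a \<noteq> 0" for a
    using that ip_pos[of a] by (intro exI[of _ "1 / sqrt (ip a a)"]) (simp add: power_divide)
  have E_g: "E g = 0" using mean by (simp add: E_def)
  have ip_g: "ip g g \<noteq> 0" using False ip_zero by blast
  have S_ne: "S \<noteq> {}" using normalise[OF E_g] scale_exists[OF ip_g] by blast
  have "continuous_on S (\<lambda>h. ip (T h) (T h))"
    unfolding ip_def T_def
    by (intro continuous_on_sum continuous_on_mult continuous_on_const cont)
  from continuous_attains_sup[OF compS S_ne this]
  obtain h where h: "h \<in> S" and h_max: "\<And>a. a \<in> S \<Longrightarrow> ip (T a) (T a) \<le> ip (T h) (T h)" by blast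
  define M where "M = ip (T h) (T h)"
  have E_h: "E h = 0" and ip_h: "ip h h = 1" using h by (auto simp: S_def)
  have bound: "ip (T a) (T a) \<le> M * ip a a" if Ea: "E a = 0" for a
  proof (cases "ip a a = 0")
    case True
    then have "T a x = 0" for x using ip_zero[OF True] by (simp add: T_def)
    then show ?thesis using True by (simp add: ip_def)
  next
    case False
    then obtain r where r: "r\<^sup>2 * ip a a = 1" using scale_exists by blast
    then obtain b where b: "b \<in> S" "\<forall>x\<in>V. b x = r * a x" using normalise[OF Ea] by blast
    have "T b x = r * T a x" for x
      using b(2) by (simp add: T_def sum_distrib_left mult_ac)
    then have "ip (T b) (T b) = r\<^sup>2 * ip (T a) (T a)"
      by (simp add: ip_def sum_distrib_left power2_eq_square mult_ac)
    with h_max[OF b(1)] have "r\<^sup>2 * ip (T a) (T a) \<le> M" by (simp add: M_def)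
    then have "r\<^sup>2 * ip (T a) (T a) * ip a a \<le> M * ip a a"
      by (intro mult_right_mono ip_pos)
    moreover have "r\<^sup>2 * ip (T a) (T a) * ip a a = ip (T a) (T a) * (r\<^sup>2 * ip a a)"
      by (simp add: mult_ac)
    ultimately show ?thesis using r by simp
  qed
  have crit: "ip (T h) (T a) = M * ip h a" if Ea: "E a = 0" for a
  proof -
    define p where "p = ip (T h) (T a) - M * ip h a"
    define q where "q = M * ip a a - ip (T a) (T a)"
    have q0: "q \<ge> 0" using bound[OF Ea] by (simp add: q_def)
    have ineq: "2 * t * p \<le> t\<^sup>2 * q" for t
    proof -
      have "ip (T (\<lambda>x. h x + t * a x)) (T (\<lambda>x. h x + t * a x))
              \<le> M * ip (\<lambda>x. h x + t * a x) (\<lambda>x. h x + t * a x)"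
        by (rule bound) (simp add: E_lin E_h Ea)
      then show ?thesis
        unfolding T_lin ip_lin ip_lin2 p_def q_def
        using ip_h ip_sym[of a h] ip_sym[of "T a" "T h"] M_def
        by (simp add: algebra_simps power2_eq_square)
    qed
    have "p = 0"
    proof (rule ccontr)
      assume "p \<noteq> 0"
      then have p2: "p\<^sup>2 > 0" by simp
      define c where "c = 1 / (q + 1)"
      have c: "c > 0" "c * q \<le> 1" using q0 by (auto simp: c_def field_simps)
      have "2 * (c * p\<^sup>2) \<le> (c * p\<^sup>2) * (c * q)"
        using ineq[of "p * c"] by (simp add: power2_eq_square mult_ac)
      also have "\<dots> \<le> (c * p\<^sup>2) * 1" using c by (intro mult_left_mono) auto
      finally have "c * p\<^sup>2 \<le> 0" by simp
      then show False using mult_pos_pos[OF c(1) p2] by simp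
    qed
    then show ?thesis by (simp add: p_def)
  qed
  have TT: "T (T h) x = M * h x" if "x \<in> V" for x
  proof -
    define a where "a = (\<lambda>x. T (T h) x + (- M) * h x)"
    have Ea: "E a = 0" unfolding a_def E_lin by (simp add: E_T E_h)
    have "ip a a = ip (T (T h)) a - M * ip h a"
      by (subst (1) a_def, subst ip_lin) simp
    also have "\<dots> = 0" using crit[OF Ea] by (simp add: T_adj)
    finally have "a x = 0" using that by (rule ip_zero)
    then show ?thesis by (simp add: a_def)
  qed
  have nonconst: "\<not> (\<exists>c. \<forall>x\<in>V. a x = c)" if Ea: "E a = 0" and a: "\<exists>x\<in>V. a x \<noteq> 0" for a
  proof
    assume "\<exists>c. \<forall>x\<in>V. a x = c"
    then obtain c where c: "\<forall>x\<in>V. a x = c" by blast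
    obtain x where x: "x \<in> V" using a by blast
    have "E a = sum w V * c" using c by (simp add: E_def sum_distrib_right)
    moreover have "sum w V > 0" using fin w x by (intro sum_pos) auto
    ultimately have "c = 0" using Ea by simp
    then show False using a c by auto
  qed
  define \<mu> where "\<mu> = sqrt M"
  have M0: "M \<ge> 0" by (simp add: M_def ip_pos)
  have \<mu>: "\<mu> \<ge> 0" "\<mu> * \<mu> = M" using M0 by (auto simp: \<mu>_def)
  have "\<bar>\<mu>\<bar> \<le> \<gamma>"
  proof (cases "\<forall>x\<in>V. T h x = \<mu> * h x")
    case True
    have "\<exists>x\<in>V. h x \<noteq> 0"
    proof (rule ccontr)
      assume "\<not> ?thesis"
      then have "ip h h = 0" by (simp add: ip_def)
      then show False using ip_h by simp
    qed
    then show ?thesis using eig[of h \<mu>] True nonconst[OF E_h] by (simp add: T_def)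
  next
    case False
    define a where "a = (\<lambda>x. T h x + (- \<mu>) * h x)"
    have "E a = 0" unfolding a_def E_lin by (simp add: E_T E_h)
    moreover have "\<exists>x\<in>V. a x \<noteq> 0" using False by (auto simp: a_def)
    ultimately have nc: "\<not> (\<exists>c. \<forall>x\<in>V. a x = c)" by (rule nonconst)
    have "T a x = (- \<mu>) * a x" if "x \<in> V" for x
      unfolding a_def T_lin using TT[OF that] \<mu>(2) by (simp add: algebra_simps)
    then have "\<bar>- \<mu>\<bar> \<le> \<gamma>" by (intro eig[OF _ nc]) (simp add: T_def)
    then show ?thesis by simp
  qed
  then have "M \<le> \<gamma>\<^sup>2"
    using \<mu> mult_mono[of \<mu> \<gamma> \<mu> \<gamma>] by (simp add: power2_eq_square)
  have "ip (T g) (T g) \<le> M * ip g g" by (rule bound[OF E_g])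
  also have "\<dots> \<le> \<gamma>\<^sup>2 * ip g g" by (intro mult_right_mono ip_pos) fact
  finally show ?thesis by (simp add: ip_def T_def power2_eq_square)
qed

subsection \<open>Weights and averaging operators\<close>

lemma card_supersets_one_larger:
  assumes "finite t" "x \<subseteq> t"
  shows "card {y. x \<subset> y \<and> y \<subseteq> t \<and> card y = Suc (card x)} = card (t - x)"
proof -
  have fx: "finite x" using assms finite_subset by blast
  have "{y. x \<subset> y \<and> y \<subseteq> t \<and> card y = Suc (card x)} = (\<lambda>v. insert v x) ` (t - x)"
  proof (intro equalityI subsetI)
    fix y assume "y \<in> {y. x \<subset> y \<and> y \<subseteq> t \<and> card y = Suc (card x)}"
    then have y: "x \<subset> y" "y \<subseteq> t" "card y = Suc (card x)" by auto
    then have "card (y - x) = 1" using fx by (simp add: card_Diff_subset psubset_imp_subset)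
    then obtain v where "y - x = {v}" using card_1_singletonE by blast
    then show "y \<in> (\<lambda>v. insert v x) ` (t - x)" using y by (intro image_eqI[of _ _ v]) auto
  qed (use assms fx in auto)
  moreover have "inj_on (\<lambda>v. insert v x) (t - x)" by (auto simp: inj_on_def)
  ultimately show ?thesis by (simp add: card_image)
qed

lemma card_subsets_one_smaller:
  assumes "finite y" "s \<subseteq> y"
  shows "card {x. s \<subseteq> x \<and> x \<subset> y \<and> Suc (card x) = card y} = card (y - s)"
proof -
  have "{x. s \<subseteq> x \<and> x \<subset> y \<and> Suc (card x) = card y} = (\<lambda>v. y - {v}) ` (y - s)"
  proof (intro equalityI subsetI)
    fix x assume "x \<in> {x. s \<subseteq> x \<and> x \<subset> y \<and> Suc (card x) = card y}"
    then have x: "s \<subseteq> x" "x \<subset> y" "Suc (card x) = card y" by auto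
    have "finite x" using x assms finite_subset by blast
    then have "card (y - x) = 1" using x by (simp add: card_Diff_subset psubset_imp_subset)
    then obtain v where "y - x = {v}" using card_1_singletonE by blast
    then show "x \<in> (\<lambda>v. y - {v}) ` (y - s)" using x by (intro image_eqI[of _ _ v]) auto
  next
    fix x assume "x \<in> (\<lambda>v. y - {v}) ` (y - s)"
    then show "x \<in> {x. s \<subseteq> x \<and> x \<subset> y \<and> Suc (card x) = card y}"
      using assms by (auto simp: card_Suc_Diff1 simp del: card_Diff_insert)
  qed
  moreover have "inj_on (\<lambda>v. y - {v}) (y - s)" by (auto simp: inj_on_def)
  ultimately show ?thesis by (simp add: card_image)
qed

definition mass :: "wcomplex \<Rightarrow> nat set \<Rightarrow> real" where
  "mass X x = (\<Sum>t\<in>{t \<in> facets X. x \<subseteq> t}. facet_wt X t)"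

definition pair_sum :: "wcomplex \<Rightarrow> nat \<Rightarrow> (nat set \<Rightarrow> real) \<Rightarrow> (nat set \<Rightarrow> real) \<Rightarrow> real" where
  "pair_sum X m f g =
     (\<Sum>x\<in>faces X m. \<Sum>z | z \<in> faces X m \<and> x \<union> z \<in> faces X (Suc m).
        level_wt X (Suc m) (x \<union> z) * (f x * g z))"

locale weighted_complex =
  fixes n :: nat and X :: wcomplex
  assumes weighted_pure: "weighted_pure_complex n X"
begin

lemma facet:
  assumes "t \<in> facets X"
  shows "t \<subseteq> {1..n}" "finite t" "card t = cdim X" "facet_wt X t > 0"
  using assms weighted_pure finite_subset[of t "{1..n}"]
  by (auto simp: weighted_pure_complex_def)

lemma finite_facets: "finite (facets X)"
  by (rule finite_subset[of _ "Pow {1..n}"], use facet(1) in blast, simp)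

lemma sum_facet_wt: "sum (facet_wt X) (facets X) = 1"
  using weighted_pure by (simp add: weighted_pure_complex_def)

lemma facets_nonempty: "facets X \<noteq> {}"
  using sum_facet_wt by auto

lemma face:
  assumes "x \<in> faces X i"
  shows "finite x" "card x = i" "i \<le> cdim X" "x \<subseteq> {1..n}"
proof -
  obtain t where t: "t \<in> facets X" "x \<subseteq> t" and c: "card x = i"
    using assms by (auto simp: faces_def)
  show "finite x" using facet(2)[OF t(1)] t(2) by (rule rev_finite_subset)
  show "card x = i" by fact
  show "i \<le> cdim X" using card_mono[OF facet(2)[OF t(1)] t(2)] facet(3)[OF t(1)] c by simp
  show "x \<subseteq> {1..n}" using facet(1)[OF t(1)] t(2) by simp
qed

lemma finite_faces [simp]: "finite (faces X i)"
  by (rule finite_subset[of _ "Pow {1..n}"], use face(4) in blast, simp)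

lemma face_subset:
  "\<lbrakk>y \<in> faces X j; x \<subseteq> y; card x = i\<rbrakk> \<Longrightarrow> x \<in> faces X i"
  by (auto simp: faces_def)

lemma faces_nonempty: "i \<le> cdim X \<Longrightarrow> faces X i \<noteq> {}"
proof -
  assume i: "i \<le> cdim X"
  obtain t where t: "t \<in> facets X" using facets_nonempty by blast
  have "i \<le> card t" using facet(3)[OF t] i by simp
  then obtain x where "x \<subseteq> t" "card x = i" by (rule obtain_subset_with_card_n)
  then have "x \<in> faces X i" using t unfolding faces_def by blast
  then show ?thesis by blast
qed

lemma faces_top: "faces X (cdim X) = facets X"
proof (intro equalityI subsetI)
  fix x assume "x \<in> faces X (cdim X)"
  then obtain t where t: "t \<in> facets X" "x \<subseteq> t" "card x = cdim X" by (auto simp: faces_def)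
  then have "x = t" using card_subset_eq[of t x] facet(2,3)[of t] by simp
  then show "x \<in> facets X" using t by simp
qed (use facet(3) in \<open>unfold faces_def, blast\<close>)

lemma faces_0: "faces X 0 = {{}}"
proof -
  have "x = {}" if "x \<in> faces X 0" for x
    using face(1,2)[OF that] by simp
  then show ?thesis using faces_nonempty[of 0] by blast
qed

lemma subfaces:
  assumes "y \<in> faces X (Suc m)"
  shows "{x \<in> faces X m. x \<subset> y} = {x. x \<subset> y \<and> Suc (card x) = card y}"
proof (intro equalityI subsetI)
  fix x assume "x \<in> {x \<in> faces X m. x \<subset> y}"
  then show "x \<in> {x. x \<subset> y \<and> Suc (card x) = card y}"
    using face(2)[of x m] face(2)[OF assms] by simp
next
  fix x assume "x \<in> {x. x \<subset> y \<and> Suc (card x) = card y}"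
  then show "x \<in> {x \<in> faces X m. x \<subset> y}"
    using face(2)[OF assms] face_subset[OF assms, of x m] by (simp add: psubset_eq)
qed

lemma card_subfaces:
  assumes "y \<in> faces X (Suc m)"
  shows "card {x \<in> faces X m. x \<subset> y} = Suc m"
  using card_subsets_one_smaller[of y "{}"] face[OF assms] by (simp add: subfaces[OF assms])

lemma mass_pos: "x \<in> faces X i \<Longrightarrow> mass X x > 0"
  unfolding mass_def using finite_facets facet(4)
  by (intro sum_pos) (auto simp: faces_def)

lemma mass_step:
  assumes "finite x" "card x = i" "i < cdim X"
  shows "(\<Sum>y | y \<in> faces X (Suc i) \<and> x \<subset> y. mass X y) = real (cdim X - i) * mass X x"
proof -
  let ?Y = "{y \<in> faces X (Suc i). x \<subset> y}"
  have "(\<Sum>y\<in>?Y. mass X y) = (\<Sum>t\<in>facets X. \<Sum>y | y \<in> ?Y \<and> y \<subseteq> t. facet_wt X t)"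
    unfolding mass_def by (rule sum.swap_restrict) (auto simp: finite_facets)
  also have "\<dots> = (\<Sum>t\<in>facets X. if x \<subseteq> t then real (cdim X - i) * facet_wt X t else 0)"
  proof (intro sum.cong refl)
    fix t assume t: "t \<in> facets X"
    show "(\<Sum>y | y \<in> ?Y \<and> y \<subseteq> t. facet_wt X t)
            = (if x \<subseteq> t then real (cdim X - i) * facet_wt X t else 0)"
    proof (cases "x \<subseteq> t")
      case True
      have "{y. y \<in> ?Y \<and> y \<subseteq> t} = {y. x \<subset> y \<and> y \<subseteq> t \<and> card y = Suc (card x)}"
        using t assms by (auto simp: faces_def)
      then have "card {y. y \<in> ?Y \<and> y \<subseteq> t} = cdim X - i"
        using card_supersets_one_larger[OF facet(2)[OF t] True] assms True facet[OF t]
        by (simp add: card_Diff_subset)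
      then show ?thesis using True by simp
    next
      case False
      then have "{y. y \<in> ?Y \<and> y \<subseteq> t} = {}" by auto
      then show ?thesis using False by (simp only: sum.empty if_False)
    qed
  qed
  also have "\<dots> = real (cdim X - i) * mass X x"
    unfolding mass_def sum_distrib_left by (rule sum.inter_filter[symmetric, OF finite_facets])
  finally show ?thesis .
qed

lemma level_wt_eq:
  assumes "finite x" "card x = i" "i \<le> cdim X" "i < cdim X \<or> x \<in> facets X"
  shows "level_wt X i x = mass X x / real (cdim X choose i)"
  using assms
proof (induction "cdim X - i" arbitrary: i x)
  case 0
  then have i: "i = cdim X" by simp
  then have x: "x \<in> facets X" using 0 by simp
  have "t = x" if "t \<in> facets X" "x \<subseteq> t" for t
    using card_subset_eq[of t x] facet[OF that(1)] facet[OF x] that by simp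
  then have "{t \<in> facets X. x \<subseteq> t} = {x}" using x by auto
  then have "mass X x = facet_wt X x" by (simp add: mass_def)
  then show ?case using i by (simp add: level_wt.simps)
next
  case (Suc r)
  then have i: "i < cdim X" by simp
  have "level_wt X i x = 1 / real (i + 1) * (\<Sum>y | y \<in> faces X (Suc i) \<and> x \<subset> y. level_wt X (Suc i) y)"
    using i by (subst level_wt.simps) simp
  also have "(\<Sum>y | y \<in> faces X (Suc i) \<and> x \<subset> y. level_wt X (Suc i) y)
               = (\<Sum>y | y \<in> faces X (Suc i) \<and> x \<subset> y. mass X y / real (cdim X choose Suc i))"
  proof (rule sum.cong[OF refl])
    fix y assume "y \<in> {y \<in> faces X (Suc i). x \<subset> y}"
    then have y: "y \<in> faces X (Suc i)" by simp
    have r: "r = cdim X - Suc i" using Suc(2) by simp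
    have "Suc i < cdim X \<or> y \<in> facets X"
    proof (cases "Suc i = cdim X")
      case True
      then show ?thesis using y faces_top by simp
    qed (use face(3)[OF y] in simp)
    then show "level_wt X (Suc i) y = mass X y / real (cdim X choose Suc i)"
      by (rule Suc(1)[OF r face(1-3)[OF y]])
  qed
  also have "\<dots> = real (cdim X - i) * mass X x / real (cdim X choose Suc i)"
    using mass_step[OF Suc(3,4) i] by (simp flip: sum_divide_distrib)
  also have "1 / real (i + 1) * (real (cdim X - i) * mass X x / real (cdim X choose Suc i))
               = mass X x / real (cdim X choose i)"
  proof -
    have "Suc i * (cdim X choose Suc i) = (cdim X - i) * (cdim X choose i)"
      using binomial_absorption[of i "cdim X"] binomial_absorb_comp[of "cdim X" i] i by simp
    then have "real (Suc i) * real (cdim X choose Suc i) = real (cdim X - i) * real (cdim X choose i)"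
      by (metis of_nat_mult)
    moreover have "1 / real (i + 1) * (real (cdim X - i) * mass X x / real (cdim X choose Suc i))
                     = real (cdim X - i) * mass X x / (real (Suc i) * real (cdim X choose Suc i))"
      by simp
    ultimately show ?thesis using i by simp
  qed
  finally show ?case .
qed

lemma level_wt_face:
  assumes "x \<in> faces X i"
  shows "level_wt X i x = mass X x / real (cdim X choose i)"
proof (rule level_wt_eq[OF face(1-3)[OF assms]])
  show "i < cdim X \<or> x \<in> facets X"
  proof (cases "i = cdim X")
    case True
    then show ?thesis using assms faces_top by simp
  qed (use face(3)[OF assms] in simp)
qed

lemma level_wt_pos: "x \<in> faces X i \<Longrightarrow> level_wt X i x > 0"
  using level_wt_face[of x i] mass_pos[of x i] face(3)[of x i] by simp

lemma level_wt_step: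
  "m < cdim X \<Longrightarrow>
     (\<Sum>y | y \<in> faces X (Suc m) \<and> x \<subset> y. level_wt X (Suc m) y) = real (Suc m) * level_wt X m x"
  by (simp add: level_wt.simps[of X m x])

lemma expect_cong: "(\<And>x. x \<in> faces X k \<Longrightarrow> f x = g x) \<Longrightarrow> expect X k f = expect X k g"
  by (simp add: expect_def)

lemma inner_cong:
  "(\<And>x. x \<in> faces X k \<Longrightarrow> f x = f' x) \<Longrightarrow> (\<And>x. x \<in> faces X k \<Longrightarrow> g x = g' x) \<Longrightarrow>
     inner_lev X k f g = inner_lev X k f' g'"
  unfolding inner_lev_def by (intro expect_cong) simp

lemma inner_sym: "inner_lev X k f g = inner_lev X k g f"
  by (simp add: inner_lev_def mult.commute)

lemma inner_diff_left:
  "inner_lev X k (\<lambda>x. f x - g x) h = inner_lev X k f h - inner_lev X k g h"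
  by (simp add: inner_lev_def expect_def algebra_simps sum_subtractf)

lemma inner_const_left: "inner_lev X k (\<lambda>_. a) g = a * expect X k g"
  by (simp add: inner_lev_def expect_def sum_distrib_left mult_ac)

lemma inner_sum_left:
  "inner_lev X k (\<lambda>x. \<Sum>i\<in>I. f i x) g = (\<Sum>i\<in>I. inner_lev X k (f i) g)"
  unfolding inner_lev_def expect_def
  by (subst sum.swap) (simp add: sum_distrib_left sum_distrib_right)

lemma inner_sum_right:
  "inner_lev X k g (\<lambda>x. \<Sum>i\<in>I. f i x) = (\<Sum>i\<in>I. inner_lev X k g (f i))"
  by (subst inner_sym, subst inner_sum_left) (simp add: inner_sym)

lemma expect_mono:
  "(\<And>x. x \<in> faces X k \<Longrightarrow> f x \<le> g x) \<Longrightarrow> expect X k f \<le> expect X k g"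
  unfolding expect_def by (rule sum_mono) (simp add: mult_le_cancel_left_pos level_wt_pos)

lemma inner_nonneg: "inner_lev X k f f \<ge> 0"
  unfolding inner_lev_def expect_def
  by (rule sum_nonneg) (simp add: less_imp_le[OF level_wt_pos])

lemma norm_sq: "(norm_lev X k f)\<^sup>2 = inner_lev X k f f"
  by (simp add: norm_lev_def inner_nonneg)

lemma norm_nonneg: "norm_lev X k f \<ge> 0"
  by (simp add: norm_lev_def inner_nonneg)

lemma inner_sq_le: "(inner_lev X k f g)\<^sup>2 \<le> inner_lev X k f f * inner_lev X k g g"
proof -
  have w: "(sqrt (level_wt X k x))\<^sup>2 = level_wt X k x" if "x \<in> faces X k" for x
    using level_wt_pos[OF that] by simp
  have eq: "(\<Sum>x\<in>faces X k. (sqrt (level_wt X k x) * a x) * (sqrt (level_wt X k x) * b x))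
          = inner_lev X k a b" for a b
    unfolding inner_lev_def expect_def
    by (intro sum.cong refl) (simp add: w[unfolded power2_eq_square] level_wt_pos abs_of_pos mult_ac)
  show ?thesis
    using Cauchy_Schwarz_ineq_sum[of "\<lambda>x. sqrt (level_wt X k x) * f x"
        "\<lambda>x. sqrt (level_wt X k x) * g x" "faces X k"]
    unfolding power2_eq_square[of "_ * _"] eq by simp
qed

lemma inner_le_norm: "\<bar>inner_lev X k f g\<bar> \<le> norm_lev X k f * norm_lev X k g"
  using inner_sq_le[of k f g]
  by (simp add: norm_lev_def inner_nonneg flip: real_sqrt_mult real_sqrt_abs)

lemma up_down_adjoint:
  assumes "m < cdim X"
  shows "inner_lev X (Suc m) (up X m f) g = inner_lev X m f (down X (Suc m) g)"
proof -
  have "inner_lev X (Suc m) (up X m f) g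
      = (\<Sum>y\<in>faces X (Suc m). \<Sum>x | x \<in> faces X m \<and> x \<subset> y.
           level_wt X (Suc m) y * f x * g y / real (Suc m))"
    by (simp add: inner_lev_def expect_def up_def sum_distrib_left sum_distrib_right
        sum_divide_distrib mult_ac)
  also have "\<dots> = (\<Sum>x\<in>faces X m. \<Sum>y | y \<in> faces X (Suc m) \<and> x \<subset> y.
           level_wt X (Suc m) y * f x * g y / real (Suc m))"
    by (rule sum.swap_restrict) auto
  also have "\<dots> = inner_lev X m f (down X (Suc m) g)"
    unfolding inner_lev_def expect_def down_def
  proof (intro sum.cong refl)
    fix x assume "x \<in> faces X m"
    then have w: "level_wt X m x \<noteq> 0" using level_wt_pos[of x m] by simp
    show "(\<Sum>y | y \<in> faces X (Suc m) \<and> x \<subset> y.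
           level_wt X (Suc m) y * f x * g y / real (Suc m))
        = level_wt X m x * (f x * (1 / real (Suc m) *
            (\<Sum>y | y \<in> faces X (Suc m) \<and> x \<subset> y.
               level_wt X (Suc m) y / level_wt X (Suc m - 1) x * g y)))"
      using w by (simp add: sum_distrib_left mult_ac)
  qed
  finally show ?thesis .
qed

lemma down_one:
  assumes "x \<in> faces X m" "m < cdim X"
  shows "down X (Suc m) (\<lambda>_. 1) x = 1"
  using level_wt_step[OF assms(2), of x] level_wt_pos[OF assms(1)]
  by (simp add: down_def flip: sum_divide_distrib)

lemma up_const: "y \<in> faces X (Suc m) \<Longrightarrow> up X m (\<lambda>_. a) y = a"
  using card_subfaces[of y m] by (simp add: up_def)

lemma expect_up: "m < cdim X \<Longrightarrow> expect X (Suc m) (up X m f) = expect X m f"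
  using up_down_adjoint[of m f "\<lambda>_. 1"] inner_cong[of m f f "down X (Suc m) (\<lambda>_. 1)" "\<lambda>_. 1"]
  by (simp add: inner_lev_def down_one)

lemma expect_down: "m < cdim X \<Longrightarrow> expect X m (down X (Suc m) g) = expect X (Suc m) g"
  using up_down_adjoint[of m "\<lambda>_. 1" g] inner_cong[of "Suc m" "up X m (\<lambda>_. 1)" "\<lambda>_. 1" g g]
  by (simp add: inner_lev_def up_const)

lemma expect_one: "k \<le> cdim X \<Longrightarrow> expect X k (\<lambda>_. 1) = 1"
proof (induction k)
  case 0
  have "{} \<in> faces X 0" by (simp add: faces_0)
  then have "level_wt X 0 {} = mass X {}" using level_wt_face by simp
  then show ?case by (simp add: expect_def faces_0 mass_def sum_facet_wt)
next
  case (Suc k)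
  have "expect X (Suc k) (\<lambda>_. 1) = expect X (Suc k) (up X k (\<lambda>_. 1))"
    by (intro expect_cong) (simp add: up_const)
  then show ?case using Suc by (simp add: expect_up)
qed

lemma norm_up_le:
  assumes "m < cdim X"
  shows "norm_lev X (Suc m) (up X m f) \<le> norm_lev X m f"
proof -
  have "inner_lev X (Suc m) (up X m f) (up X m f) \<le> expect X (Suc m) (up X m (\<lambda>x. f x * f x))"
    unfolding inner_lev_def
  proof (rule expect_mono)
    fix y assume y: "y \<in> faces X (Suc m)"
    let ?A = "{x \<in> faces X m. x \<subset> y}"
    have "(\<Sum>x\<in>?A. f x)\<^sup>2 \<le> (\<Sum>x\<in>?A. (f x)\<^sup>2) * real (card ?A)"
      by (rule sum_squared_le_sum_of_squares)
    then have "(\<Sum>x\<in>?A. f x)\<^sup>2 / (real (Suc m))\<^sup>2 \<le> (\<Sum>x\<in>?A. (f x)\<^sup>2) * real (Suc m) / (real (Suc m))\<^sup>2"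
      unfolding card_subfaces[OF y] by (intro divide_right_mono) auto
    then show "up X m f y * up X m f y \<le> up X m (\<lambda>x. f x * f x) y"
      by (simp add: up_def power2_eq_square)
  qed
  then show ?thesis
    unfolding expect_up[OF assms] norm_lev_def inner_lev_def[of X m] by simp
qed

lemma norm_down_le:
  assumes "m < cdim X"
  shows "norm_lev X m (down X (Suc m) g) \<le> norm_lev X (Suc m) g"
proof -
  let ?d = "norm_lev X m (down X (Suc m) g)"
  have "?d * ?d = inner_lev X (Suc m) (up X m (down X (Suc m) g)) g"
    using up_down_adjoint[OF assms] by (simp add: norm_sq flip: power2_eq_square)
  also have "\<dots> \<le> norm_lev X (Suc m) (up X m (down X (Suc m) g)) * norm_lev X (Suc m) g"
    using inner_le_norm abs_le_D1 by blast
  also have "\<dots> \<le> ?d * norm_lev X (Suc m) g"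
    by (intro mult_right_mono norm_up_le norm_nonneg assms)
  finally show ?thesis
    using norm_nonneg[of m "down X (Suc m) g"] norm_nonneg[of "Suc m" g]
    by (cases "?d = 0") (auto simp: mult_le_cancel_left)
qed

lemma up_iter_same [simp]: "up_iter X l l f = f"
  by (cases l) auto

lemma down_iter_same [simp]: "down_iter X l l f = f"
  by (cases l) auto

lemma up_iter_down_iter_adjoint:
  "\<lbrakk>l \<le> k; k \<le> cdim X\<rbrakk> \<Longrightarrow>
     inner_lev X k (up_iter X l k f) g = inner_lev X l f (down_iter X l k g)"
proof (induction k arbitrary: g)
  case (Suc k)
  then show ?case
    by (cases "l = Suc k") (auto simp: up_down_adjoint simp del: up_iter.simps(2) down_iter.simps(2)
        simp: up_iter.simps(2)[of X l k] down_iter.simps(2)[of X l k])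
qed simp

lemma norm_up_iter_le:
  "\<lbrakk>l \<le> k; k \<le> cdim X\<rbrakk> \<Longrightarrow> norm_lev X k (up_iter X l k f) \<le> norm_lev X l f"
proof (induction k)
  case (Suc k)
  show ?case
  proof (cases "l = Suc k")
    case False
    then have "norm_lev X (Suc k) (up X k (up_iter X l k f)) \<le> norm_lev X k (up_iter X l k f)"
      using Suc.prems by (intro norm_up_le) auto
    then show ?thesis using Suc False by simp
  qed simp
qed simp

lemma expect_down_iter:
  "\<lbrakk>l \<le> k; k \<le> cdim X\<rbrakk> \<Longrightarrow> expect X l (down_iter X l k g) = expect X k g"
proof (induction k arbitrary: g)
  case (Suc k)
  then show ?case
    by (cases "l = Suc k") (auto simp: expect_down)
qed simp

subsection \<open>Links\<close>

lemma inner_up_up: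
  assumes m: "m < cdim X"
  shows "inner_lev X (Suc m) (up X m f) (up X m g)
           = inner_lev X m f g / real (Suc m) + pair_sum X m f g / (real (Suc m))\<^sup>2"
proof -
  define w where "w = level_wt X (Suc m)"
  define c where "c = (real (Suc m))\<^sup>2"
  let ?F = "faces X m" and ?G = "faces X (Suc m)"
  have "c * inner_lev X (Suc m) (up X m f) (up X m g)
      = (\<Sum>y\<in>?G. w y * ((\<Sum>x | x \<in> ?F \<and> x \<subset> y. f x) * (\<Sum>z | z \<in> ?F \<and> z \<subset> y. g z)))"
  proof -
    define a where "a = real (Suc m)"
    have a: "a \<noteq> 0" "c = a * a" by (simp_all add: a_def c_def power2_eq_square)
    have "up X m h y = (\<Sum>x | x \<in> ?F \<and> x \<subset> y. h x) / a" for h y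
      by (simp add: up_def a_def)
    then show ?thesis
      unfolding inner_lev_def expect_def w_def using a
      by (subst sum_distrib_left) (intro sum.cong refl, simp)
  qed
  also have "\<dots> = (\<Sum>y\<in>?G. \<Sum>x | x \<in> ?F \<and> x \<subset> y. \<Sum>z | z \<in> ?F \<and> z \<subset> y. w y * (f x * g z))"
    by (simp only: sum_product) (simp only: sum_distrib_left)
  also have "\<dots> = (\<Sum>x\<in>?F. \<Sum>y | y \<in> ?G \<and> x \<subset> y. \<Sum>z | z \<in> ?F \<and> z \<subset> y. w y * (f x * g z))"
    by (rule sum.swap_restrict) auto
  also have "\<dots> = (\<Sum>x\<in>?F. \<Sum>y | y \<in> ?G \<and> x \<subset> y. w y * (f x * g x)
                    + (\<Sum>z | z \<in> ?F \<and> (z \<subset> y \<and> z \<noteq> x). w y * (f x * g z)))"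
  proof (intro sum.cong refl)
    fix x y assume x: "x \<in> ?F" and y: "y \<in> {y \<in> ?G. x \<subset> y}"
    have "{z. z \<in> ?F \<and> z \<subset> y} = insert x {z. z \<in> ?F \<and> (z \<subset> y \<and> z \<noteq> x)}" using x y by auto
    then show "(\<Sum>z | z \<in> ?F \<and> z \<subset> y. w y * (f x * g z)) = w y * (f x * g x)
                 + (\<Sum>z | z \<in> ?F \<and> (z \<subset> y \<and> z \<noteq> x). w y * (f x * g z))"
      by simp
  qed
  also have "\<dots> = (\<Sum>x\<in>?F. \<Sum>y | y \<in> ?G \<and> x \<subset> y. w y * (f x * g x))
      + (\<Sum>x\<in>?F. \<Sum>y | y \<in> ?G \<and> x \<subset> y. \<Sum>z | z \<in> ?F \<and> (z \<subset> y \<and> z \<noteq> x). w y * (f x * g z))"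
    by (simp add: sum.distrib)
  also have "(\<Sum>x\<in>?F. \<Sum>y | y \<in> ?G \<and> x \<subset> y. w y * (f x * g x)) = real (Suc m) * inner_lev X m f g"
    unfolding w_def inner_lev_def expect_def
    by (subst sum_distrib_left, intro sum.cong refl)
      (simp add: level_wt_step[OF m] flip: sum_distrib_right)
  also have "(\<Sum>x\<in>?F. \<Sum>y | y \<in> ?G \<and> x \<subset> y. \<Sum>z | z \<in> ?F \<and> (z \<subset> y \<and> z \<noteq> x). w y * (f x * g z))
      = pair_sum X m f g"
    unfolding pair_sum_def
  proof (rule sum.cong[OF refl])
    fix x assume x: "x \<in> ?F"
    have "(\<Sum>y | y \<in> ?G \<and> x \<subset> y. \<Sum>z | z \<in> ?F \<and> (z \<subset> y \<and> z \<noteq> x). w y * (f x * g z))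
        = (\<Sum>z\<in>?F. \<Sum>y | y \<in> {y \<in> ?G. x \<subset> y} \<and> (z \<subset> y \<and> z \<noteq> x). w y * (f x * g z))"
      by (rule sum.swap_restrict) auto
    also have "\<dots> = (\<Sum>z\<in>?F. if x \<union> z \<in> ?G then w (x \<union> z) * (f x * g z) else 0)"
    proof (intro sum.cong refl)
      fix z assume z: "z \<in> ?F"
      have union: "y = x \<union> z" if y: "y \<in> ?G" "x \<subset> y" "z \<subset> y" "z \<noteq> x" for y
      proof -
        have fx: "finite x" "card x = m" and fz: "finite z" "card z = m"
          using face[OF x] face[OF z] by auto
        have fy: "finite y" "card y = Suc m" using face[OF y(1)] by auto
        have "x \<noteq> x \<union> z"
        proof
          assume "x = x \<union> z"
          then have "z \<subseteq> x" by blast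
          then show False using card_subset_eq[OF fx(1), of z] fx fz y(4) by simp
        qed
        then have "card x < card (x \<union> z)"
          by (intro psubset_card_mono) (use fx fz in auto)
        then have "card y \<le> card (x \<union> z)" using fx fy by simp
        then show ?thesis using card_seteq[OF fy(1), of "x \<union> z"] y by auto
      qed
      show "(\<Sum>y | y \<in> {y \<in> ?G. x \<subset> y} \<and> (z \<subset> y \<and> z \<noteq> x). w y * (f x * g z))
              = (if x \<union> z \<in> ?G then w (x \<union> z) * (f x * g z) else 0)"
      proof (cases "x \<union> z \<in> ?G")
        case True
        have "card (x \<union> z) = Suc m" "card x = m" "card z = m" using face(2) True x z by auto
        then have "x \<noteq> x \<union> z" "z \<noteq> x \<union> z" "z \<noteq> x" by (auto simp: Un_absorb)
        then have "{y. y \<in> {y \<in> ?G. x \<subset> y} \<and> (z \<subset> y \<and> z \<noteq> x)} = {x \<union> z}"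
          using True union by blast
        then show ?thesis using True by simp
      next
        case False
        then have "{y. y \<in> {y \<in> ?G. x \<subset> y} \<and> (z \<subset> y \<and> z \<noteq> x)} = {}" using union by blast
        then show ?thesis using False by (simp only: sum.empty if_False)
      qed
    qed
    also have "\<dots> = (\<Sum>z | z \<in> ?F \<and> x \<union> z \<in> ?G. w (x \<union> z) * (f x * g z))"
      by (rule sum.inter_filter[symmetric]) simp
    finally show "(\<Sum>y | y \<in> ?G \<and> x \<subset> y. \<Sum>z | z \<in> ?F \<and> (z \<subset> y \<and> z \<noteq> x). w y * (f x * g z))
        = (\<Sum>z | z \<in> ?F \<and> x \<union> z \<in> ?G. level_wt X (Suc m) (x \<union> z) * (f x * g z))"
      by (simp add: w_def)
  qed
  finally have "c * inner_lev X (Suc m) (up X m f) (up X m g)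
    = real (Suc m) * inner_lev X m f g + pair_sum X m f g" .
  moreover have "c \<noteq> 0" by (simp add: c_def)
  ultimately have "inner_lev X (Suc m) (up X m f) (up X m g)
    = (real (Suc m) * inner_lev X m f g + pair_sum X m f g) / c"
    by (simp add: nonzero_eq_divide_eq mult.commute)
  then show ?thesis
    by (simp add: add_divide_distrib c_def power2_eq_square del: of_nat_Suc)
qed

lemma facets_link: "facets (link X s) = (\<lambda>t. t - s) ` {t \<in> facets X. s \<subseteq> t}"
  by (auto simp: link_def)

lemma cdim_link: "cdim (link X s) = cdim X - card s"
  by (simp add: link_def)

lemma facet_wt_link: "s \<subseteq> t \<Longrightarrow> facet_wt (link X s) (t - s) = facet_wt X t / mass X s"
  by (simp add: link_def mass_def Un_absorb1)

lemma weighted_complex_link: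
  assumes "s \<in> faces X r"
  shows "weighted_complex n (link X s)"
proof
  have inj: "inj_on (\<lambda>t. t - s) {t \<in> facets X. s \<subseteq> t}" by (auto simp: inj_on_def)
  have "(\<Sum>t\<in>facets (link X s). facet_wt (link X s) t)
      = (\<Sum>t | t \<in> facets X \<and> s \<subseteq> t. facet_wt X t / mass X s)"
    unfolding facets_link by (subst sum.reindex[OF inj]) (auto intro: sum.cong simp: facet_wt_link)
  also have "\<dots> = 1" using mass_pos[OF assms] by (simp add: mass_def flip: sum_divide_distrib)
  finally have "(\<Sum>t\<in>facets (link X s). facet_wt (link X s) t) = 1" .
  moreover have "t - s \<subseteq> {1..n}" "card (t - s) = cdim X - card s" "facet_wt (link X s) (t - s) > 0"
    if "t \<in> facets X" "s \<subseteq> t" for t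
    using facet[OF that(1)] that face(1)[OF assms] mass_pos[OF assms]
    by (auto simp: card_Diff_subset facet_wt_link)
  ultimately show "weighted_pure_complex n (link X s)"
    unfolding weighted_pure_complex_def facets_link cdim_link by auto
qed

lemma faces_link:
  assumes "s \<in> faces X r"
  shows "faces (link X s) j = {t. t \<inter> s = {} \<and> s \<union> t \<in> faces X (r + j)}"
proof (intro equalityI subsetI)
  fix t assume "t \<in> faces (link X s) j"
  then obtain y where y: "y \<in> facets X" "s \<subseteq> y" "t \<subseteq> y - s" "card t = j"
    by (auto simp: faces_def facets_link)
  have "finite t" using y(3) facet(2)[OF y(1)] by (meson finite_Diff finite_subset)
  then have "card (s \<union> t) = r + j"
    using y face(1,2)[OF assms] by (subst card_Un_disjoint) auto
  moreover have "s \<union> t \<subseteq> y" using y by blast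
  ultimately show "t \<in> {t. t \<inter> s = {} \<and> s \<union> t \<in> faces X (r + j)}"
    using y by (auto simp: faces_def)
next
  fix t assume t: "t \<in> {t. t \<inter> s = {} \<and> s \<union> t \<in> faces X (r + j)}"
  then have "finite t" "card (s \<union> t) = r + j" using face(1,2)[of "s \<union> t" "r + j"] by auto
  then have "card t = j" using t face(1,2)[OF assms] by (simp add: card_Un_disjoint Int_commute)
  moreover obtain y where "y \<in> facets X" "s \<union> t \<subseteq> y" using t by (auto simp: faces_def)
  ultimately show "t \<in> faces (link X s) j" using t by (auto simp: faces_def facets_link)
qed

lemma mass_link:
  assumes "t \<inter> s = {}"
  shows "mass (link X s) t = mass X (s \<union> t) / mass X s"
proof -
  have "{y \<in> facets (link X s). t \<subseteq> y} = (\<lambda>y. y - s) ` {y \<in> facets X. s \<union> t \<subseteq> y}"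
    using assms by (auto simp: facets_link)
  moreover have "inj_on (\<lambda>y. y - s) {y \<in> facets X. s \<union> t \<subseteq> y}" by (auto simp: inj_on_def)
  ultimately have "mass (link X s) t = (\<Sum>y | y \<in> facets X \<and> s \<union> t \<subseteq> y. facet_wt X y / mass X s)"
    unfolding mass_def[of "link X s"]
    by (simp only: sum.reindex o_def) (auto intro: sum.cong simp: facet_wt_link)
  then show ?thesis by (simp add: mass_def sum_divide_distrib)
qed

lemma level_wt_link:
  assumes s: "s \<in> faces X r" and t: "t \<in> faces (link X s) j"
  shows "level_wt (link X s) j t
           = level_wt X (r + j) (s \<union> t) / (level_wt X r s * real (r + j choose r))"
proof -
  interpret L: weighted_complex n "link X s" by (rule weighted_complex_link) fact
  have st: "s \<union> t \<in> faces X (r + j)" "t \<inter> s = {}" using t by (auto simp: faces_link[OF s])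
  have le: "r + j \<le> cdim X" using face(3)[OF st(1)] .
  have "level_wt (link X s) j t = mass X (s \<union> t) / mass X s / real (cdim X - r choose j)"
    using L.level_wt_face[OF t] by (simp add: mass_link st cdim_link face(2)[OF s])
  moreover have "real (cdim X choose (r + j)) * real (r + j choose r)
      = real (cdim X choose r) * real (cdim X - r choose j)"
    using choose_mult[of r "r + j" "cdim X"] le by (simp flip: of_nat_mult)
  moreover have "real (cdim X choose r) > 0" using le by simp
  ultimately have "mass X (s \<union> t) * real (cdim X choose r) /
        (mass X s * (real (cdim X choose (r + j)) * real (r + j choose r)))
      = level_wt (link X s) j t"
    by simp
  then show ?thesis
    unfolding level_wt_face[OF s] level_wt_face[OF st(1)] by (simp add: mult_ac)
qed

lemma expect_link:
  assumes s: "s \<in> faces X r"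
  shows "expect (link X s) 1 (\<lambda>t. f (s \<union> t)) = down X (Suc r) f s"
proof -
  have "expect (link X s) 1 (\<lambda>t. f (s \<union> t))
      = (\<Sum>t\<in>faces (link X s) 1. level_wt X (Suc r) (s \<union> t) / (level_wt X r s * real (Suc r)) * f (s \<union> t))"
    unfolding expect_def by (intro sum.cong refl) (simp add: level_wt_link[OF s])
  also have "\<dots> = (\<Sum>y | y \<in> faces X (Suc r) \<and> s \<subset> y.
                    level_wt X (Suc r) y / (level_wt X r s * real (Suc r)) * f y)"
  proof (rule sum.reindex_bij_witness[of _ "\<lambda>y. y - s" "\<lambda>t. s \<union> t"])
    fix t assume "t \<in> faces (link X s) 1"
    then have t: "t \<inter> s = {}" "s \<union> t \<in> faces X (Suc r)" by (auto simp: faces_link[OF s])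
    then have "s \<noteq> s \<union> t" using face(2)[OF s] face(2)[OF t(2)] by auto
    then show "s \<union> t \<in> {y \<in> faces X (Suc r). s \<subset> y}" using t by auto
    show "s \<union> t - s = t" using t by auto
  next
    fix y assume "y \<in> {y \<in> faces X (Suc r). s \<subset> y}"
    then have y: "y \<in> faces X (Suc r)" "s \<union> (y - s) = y" by auto
    then show "s \<union> (y - s) = y" by simp
    show "y - s \<in> faces (link X s) 1" using y by (auto simp: faces_link[OF s])
  qed simp
  also have "\<dots> = down X (Suc r) f s"
    by (simp add: down_def sum_distrib_left mult_ac)
  finally show ?thesis .
qed

lemma level_wt_edges:
  assumes "2 \<le> cdim X"
  shows "(\<Sum>e | e \<in> faces X 2 \<and> x \<subset> e. level_wt X 2 e) = 2 * level_wt X 1 x"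
  using level_wt_step[of 1 x] assms by (simp add: numeral_2_eq_2)

lemma inner_walk:
  assumes "2 \<le> cdim X"
  shows "inner_lev X 1 f (walk X g) = pair_sum X 1 f g / 2"
proof -
  have "inner_lev X 1 f (walk X g) = (\<Sum>x\<in>faces X 1. \<Sum>y | y \<in> faces X 1 \<and> x \<union> y \<in> faces X 2.
          level_wt X 2 (x \<union> y) * (f x * g y) / 2)"
    unfolding inner_lev_def expect_def
  proof (intro sum.cong refl)
    fix x assume x: "x \<in> faces X 1"
    show "level_wt X 1 x * (f x * walk X g x)
      = (\<Sum>y | y \<in> faces X 1 \<and> x \<union> y \<in> faces X 2. level_wt X 2 (x \<union> y) * (f x * g y) / 2)"
      using level_wt_pos[OF x] unfolding walk_def level_wt_edges[OF assms] sum_distrib_left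
      by (intro sum.cong refl) simp
  qed
  then show ?thesis by (simp add: pair_sum_def numeral_2_eq_2 sum_divide_distrib)
qed

lemma sum_walk_weights:
  assumes x: "x \<in> faces X 1"
  shows "(\<Sum>y | y \<in> faces X 1 \<and> x \<union> y \<in> faces X 2. level_wt X 2 (x \<union> y))
           = (\<Sum>e | e \<in> faces X 2 \<and> x \<subset> e. level_wt X 2 e)"
proof (rule sum.reindex_bij_witness[of _ "\<lambda>e. e - x" "\<lambda>y. x \<union> y"])
  obtain u where u: "x = {u}" using face(2)[OF x] card_1_singletonE by blast
  {
    fix y assume y: "y \<in> {y \<in> faces X 1. x \<union> y \<in> faces X 2}"
    then obtain v where v: "y = {v}" using face(2)[of y 1] card_1_singletonE by blast
    have "card (x \<union> y) = 2" using y face(2)[of "x \<union> y" 2] by simp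
    then have "u \<noteq> v" using u v by auto
    then show "x \<union> y - x = y" "x \<union> y \<in> {e \<in> faces X 2. x \<subset> e}" using y u v by (auto simp: insert_commute)
  next
    fix e assume e: "e \<in> {e \<in> faces X 2. x \<subset> e}"
    then have e': "e \<in> faces X 2" "x \<subseteq> e" by auto
    then have "card (e - x) = 1" using face(1,2)[OF e'(1)] face(1,2)[OF x] by (simp add: card_Diff_subset)
    then show "e - x \<in> {y \<in> faces X 1. x \<union> y \<in> faces X 2}" "x \<union> (e - x) = e"
      using face_subset[OF e'(1), of "e - x" 1] e' by (auto simp: Un_absorb1)
  }
qed simp

lemma walk_one:
  assumes "2 \<le> cdim X" and x: "x \<in> faces X 1"
  shows "walk X (\<lambda>_. 1) x = 1"
  unfolding walk_def
  using sum_walk_weights[OF x] level_wt_edges[OF assms(1), of x] level_wt_pos[OF x]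
  by (simp flip: sum_divide_distrib)

lemma walk_contraction:
  assumes d: "2 \<le> cdim X"
    and eig: "\<And>\<mu>. nontrivial_eigenvalue X \<mu> \<Longrightarrow> \<bar>\<mu>\<bar> \<le> \<gamma>"
    and \<gamma>: "0 \<le> \<gamma>" and mean: "expect X 1 g = 0"
  shows "norm_lev X 1 (walk X g) \<le> \<gamma> * norm_lev X 1 g"
proof -
  define K where "K = (\<lambda>x y. if x \<union> y \<in> faces X 2 then level_wt X 2 (x \<union> y) / (2 * level_wt X 1 x) else 0)"
  have walk: "walk X h x = (\<Sum>y\<in>faces X 1. K x y * h y)" for h x
    unfolding walk_def level_wt_edges[OF d] K_def
    by (subst sum.inter_filter) (auto intro!: sum.cong)
  have "(\<Sum>x\<in>faces X 1. level_wt X 1 x * (\<Sum>y\<in>faces X 1. K x y * g y)\<^sup>2)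
          \<le> \<gamma>\<^sup>2 * (\<Sum>x\<in>faces X 1. level_wt X 1 x * (g x)\<^sup>2)"
  proof (rule mean_zero_contraction)
    fix x y assume "x \<in> faces X 1" "y \<in> faces X 1"
    then show "level_wt X 1 x * K x y = level_wt X 1 y * K y x"
      using level_wt_pos[of x 1] level_wt_pos[of y 1] by (simp add: K_def Un_commute)
  next
    fix x assume x: "x \<in> faces X 1"
    have "(\<Sum>y\<in>faces X 1. K x y) = walk X (\<lambda>_. 1) x" by (simp add: walk)
    also have "\<dots> = 1" using d x by (rule walk_one)
    finally show "(\<Sum>y\<in>faces X 1. K x y) = 1" .
  next
    fix \<mu> h assume "\<forall>x\<in>faces X 1. (\<Sum>y\<in>faces X 1. K x y * h y) = \<mu> * h x"
      "\<not> (\<exists>a. \<forall>x\<in>faces X 1. h x = a)"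
    then show "\<bar>\<mu>\<bar> \<le> \<gamma>" by (intro eig) (auto simp: nontrivial_eigenvalue_def walk)
  qed (use mean in \<open>simp_all add: level_wt_pos expect_def\<close>)
  then have "(norm_lev X 1 (walk X g))\<^sup>2 \<le> (\<gamma> * norm_lev X 1 g)\<^sup>2"
    unfolding power_mult_distrib norm_sq inner_lev_def expect_def walk
    by (simp add: power2_eq_square)
  then show ?thesis by (rule power2_le_imp_le) (simp add: \<gamma> norm_nonneg)
qed

lemma walk_near_expectation:
  assumes d: "2 \<le> cdim X"
    and eig: "\<And>\<mu>. nontrivial_eigenvalue X \<mu> \<Longrightarrow> \<bar>\<mu>\<bar> \<le> \<gamma>" and \<gamma>: "0 \<le> \<gamma>"
  shows "\<bar>inner_lev X 1 f (walk X g) - expect X 1 f * expect X 1 g\<bar>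
           \<le> \<gamma> * (norm_lev X 1 f * norm_lev X 1 g)"
proof -
  define \<mu> where "\<mu> = expect X 1 g"
  define h where "h = (\<lambda>x. g x - \<mu>)"
  have one: "expect X 1 (\<lambda>_. 1) = 1" using d by (intro expect_one) simp
  have Ea: "expect X 1 (\<lambda>x. a x - b * c x) = expect X 1 a - b * expect X 1 c" for a b c
    by (simp add: expect_def algebra_simps sum_subtractf sum_distrib_left)
  have Eh: "expect X 1 h = 0" using Ea[of g \<mu> "\<lambda>_. 1"] one by (simp add: h_def \<mu>_def)
  have walk_h: "walk X h x = walk X g x - \<mu>" if x: "x \<in> faces X 1" for x
  proof -
    have "walk X (\<lambda>_. 1) x = 1" using d x by (rule walk_one)
    moreover have "walk X h x = walk X g x - \<mu> * walk X (\<lambda>_. 1) x"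
      unfolding walk_def h_def sum_distrib_left sum_subtractf[symmetric]
      by (intro sum.cong refl) (simp only: left_diff_distrib right_diff_distrib mult_1_left mult_1_right mult_ac)
    ultimately show ?thesis by simp
  qed
  have "inner_lev X 1 f (walk X h) = expect X 1 (\<lambda>x. f x * walk X g x - \<mu> * f x)"
    unfolding inner_lev_def by (intro expect_cong) (simp add: walk_h algebra_simps)
  also have "\<dots> = inner_lev X 1 f (walk X g) - expect X 1 f * expect X 1 g"
    unfolding Ea by (simp add: inner_lev_def \<mu>_def)
  finally have "\<bar>inner_lev X 1 f (walk X g) - expect X 1 f * expect X 1 g\<bar>
                  \<le> norm_lev X 1 f * norm_lev X 1 (walk X h)"
    using inner_le_norm[of 1 f "walk X h"] by simp
  also have "\<dots> \<le> norm_lev X 1 f * (\<gamma> * norm_lev X 1 h)"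
    by (intro mult_left_mono walk_contraction[OF d eig \<gamma> Eh] norm_nonneg)
  also have "\<dots> \<le> norm_lev X 1 f * (\<gamma> * norm_lev X 1 g)"
  proof -
    have "inner_lev X 1 h h = inner_lev X 1 g h - \<mu> * expect X 1 h"
      unfolding h_def inner_diff_left inner_const_left by simp
    also have "\<dots> = inner_lev X 1 h g" using Eh by (simp add: inner_sym)
    also have "\<dots> = inner_lev X 1 g g - \<mu> * \<mu>"
      unfolding h_def inner_diff_left inner_const_left by (simp add: \<mu>_def)
    finally have "inner_lev X 1 h h \<le> inner_lev X 1 g g" by simp
    then have "norm_lev X 1 h \<le> norm_lev X 1 g" by (simp add: norm_lev_def)
    then show ?thesis by (intro mult_left_mono \<gamma> norm_nonneg)
  qed
  finally show ?thesis by (simp only: mult_ac)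
qed

lemma inner_walk_link:
  assumes s: "s \<in> faces X r" and r: "r + 2 \<le> cdim X"
  shows "level_wt X r s * inner_lev (link X s) 1 (\<lambda>t. f (s \<union> t)) (walk (link X s) (\<lambda>t. g (s \<union> t)))
    = (\<Sum>u\<in>faces (link X s) 1. \<Sum>v | v \<in> faces (link X s) 1 \<and> u \<union> v \<in> faces (link X s) 2.
         level_wt X (r + 2) (s \<union> (u \<union> v)) * (f (s \<union> u) * g (s \<union> v)))
      / (real (r + 1) * real (r + 2))"
proof -
  interpret L: weighted_complex n "link X s" by (rule weighted_complex_link) fact
  let ?L = "link X s"
  have two: "2 \<le> cdim ?L" using r face(2)[OF s] by (simp add: cdim_link)
  have w: "level_wt X r s > 0" using s by (rule level_wt_pos)
  have choose: "real (r + 2 choose r) = real (r + 1) * real (r + 2) / 2"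
  proof -
    have "r + 2 choose r = (r + 2 choose 2)" using binomial_symmetric[of r "r + 2"] by simp
    also have "\<dots> = (r + 2) * (r + 1) div 2" by (simp add: choose_two)
    finally have "real (r + 2 choose r) = real ((r + 2) * (r + 1) div 2)" by (rule arg_cong)
    also have "\<dots> = real ((r + 2) * (r + 1)) / real 2" by (rule real_of_nat_div) simp
    finally show ?thesis by (simp only: of_nat_mult of_nat_numeral mult.commute)
  qed
  have "level_wt X r s * inner_lev ?L 1 (\<lambda>t. f (s \<union> t)) (walk ?L (\<lambda>t. g (s \<union> t)))
    = (\<Sum>u\<in>faces ?L 1. \<Sum>v | v \<in> faces ?L 1 \<and> u \<union> v \<in> faces ?L 2.
         level_wt X r s * (level_wt ?L 2 (u \<union> v) * (f (s \<union> u) * g (s \<union> v)) / 2))"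
    unfolding L.inner_walk[OF two] pair_sum_def
    by (simp add: sum_distrib_left sum_divide_distrib numeral_2_eq_2)
  also have "\<dots> = (\<Sum>u\<in>faces ?L 1. \<Sum>v | v \<in> faces ?L 1 \<and> u \<union> v \<in> faces ?L 2.
      level_wt X (r + 2) (s \<union> (u \<union> v)) * (f (s \<union> u) * g (s \<union> v)) / (real (r + 1) * real (r + 2)))"
  proof (intro sum.cong refl)
    fix u v assume "v \<in> {v. v \<in> faces ?L 1 \<and> u \<union> v \<in> faces ?L 2}"
    then have "level_wt ?L 2 (u \<union> v)
        = level_wt X (r + 2) (s \<union> (u \<union> v)) / (level_wt X r s * (real (r + 1) * real (r + 2) / 2))"
      using level_wt_link[OF s, of "u \<union> v" 2] by (simp only: choose mem_Collect_eq simp_thms)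
    then show "level_wt X r s * (level_wt ?L 2 (u \<union> v) * (f (s \<union> u) * g (s \<union> v)) / 2)
      = level_wt X (r + 2) (s \<union> (u \<union> v)) * (f (s \<union> u) * g (s \<union> v)) / (real (r + 1) * real (r + 2))"
      using w by simp
  qed
  finally show ?thesis by (simp only: sum_divide_distrib)
qed

text \<open>Two \<open>(r + 1)\<close>-faces whose union is an \<open>(r + 2)\<close>-face are a pair of adjacent vertices in the
  link of their intersection.\<close>

lemma pair_sum_links:
  assumes r: "r + 2 \<le> cdim X"
  shows "pair_sum X (Suc r) f g / (real (r + 1) * real (r + 2))
    = (\<Sum>s\<in>faces X r. level_wt X r s *
         inner_lev (link X s) 1 (\<lambda>t. f (s \<union> t)) (walk (link X s) (\<lambda>t. g (s \<union> t))))"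
proof -
  let ?F = "faces X (Suc r)"
  let ?A = "\<lambda>s. faces (link X s) 1"
  let ?B = "\<lambda>s u. {v \<in> faces (link X s) 1. u \<union> v \<in> faces (link X s) 2}"
  let ?w = "level_wt X (r + 2)"
  have fin: "finite (?A s)" if "s \<in> faces X r" for s
    using weighted_complex.finite_faces[OF weighted_complex_link[OF that]] .
  have "(\<Sum>s\<in>faces X r. \<Sum>u\<in>?A s. \<Sum>v\<in>?B s u. ?w (s \<union> (u \<union> v)) * (f (s \<union> u) * g (s \<union> v)))
    = (\<Sum>(s, u, v)\<in>(SIGMA s:faces X r. SIGMA u:?A s. ?B s u).
         ?w (s \<union> (u \<union> v)) * (f (s \<union> u) * g (s \<union> v)))"
  proof -
    have "(\<Sum>s\<in>faces X r. \<Sum>u\<in>?A s. \<Sum>v\<in>?B s u. ?w (s \<union> (u \<union> v)) * (f (s \<union> u) * g (s \<union> v)))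
      = (\<Sum>s\<in>faces X r. \<Sum>(u, v)\<in>(SIGMA u:?A s. ?B s u).
           ?w (s \<union> (u \<union> v)) * (f (s \<union> u) * g (s \<union> v)))"
      by (intro sum.cong refl sum.Sigma) (auto simp: fin[unfolded One_nat_def])
    also have "\<dots> = (\<Sum>(s, p)\<in>(SIGMA s:faces X r. SIGMA u:?A s. ?B s u).
         case p of (u, v) \<Rightarrow> ?w (s \<union> (u \<union> v)) * (f (s \<union> u) * g (s \<union> v)))"
      by (intro sum.Sigma) (auto intro!: finite_SigmaI simp: fin[unfolded One_nat_def])
    finally show ?thesis .
  qed
  also have "\<dots> = (\<Sum>(x, z)\<in>(SIGMA x:?F. {z \<in> ?F. x \<union> z \<in> faces X (Suc (Suc r))}). ?w (x \<union> z) * (f x * g z))"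
  proof (rule sum.reindex_bij_witness[of _ "\<lambda>(x, z). (x \<inter> z, x - z, z - x)" "\<lambda>(s, u, v). (s \<union> u, s \<union> v)"])
    fix p assume "p \<in> (SIGMA s:faces X r. SIGMA u:?A s. ?B s u)"
    then obtain s u v where p: "p = (s, u, v)" and s: "s \<in> faces X r"
      and u: "u \<in> ?A s" and v: "v \<in> ?A s" and uv: "u \<union> v \<in> faces (link X s) 2" by auto
    interpret L: weighted_complex n "link X s" by (rule weighted_complex_link) fact
    have fs: "u \<inter> s = {}" "s \<union> u \<in> ?F" "v \<inter> s = {}" "s \<union> v \<in> ?F" "s \<union> (u \<union> v) \<in> faces X (Suc (Suc r))"
      using u v uv by (auto simp: faces_link[OF s])
    obtain a b where "u = {a}" "v = {b}"
      using L.face(2)[OF u] L.face(2)[OF v] card_1_singletonE by metis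
    then have "u \<inter> v = {}" using L.face(2)[OF uv] by (cases "a = b") auto
    then show "(case case p of (s, u, v) \<Rightarrow> (s \<union> u, s \<union> v) of (x, z) \<Rightarrow> (x \<inter> z, x - z, z - x)) = p"
      using fs by (auto simp: p)
    have "(s \<union> u) \<union> (s \<union> v) = s \<union> (u \<union> v)" by blast
    then show "(case p of (s, u, v) \<Rightarrow> (s \<union> u, s \<union> v))
        \<in> (SIGMA x:?F. {z \<in> ?F. x \<union> z \<in> faces X (Suc (Suc r))})"
      and "(case case p of (s, u, v) \<Rightarrow> (s \<union> u, s \<union> v) of (x, z) \<Rightarrow> ?w (x \<union> z) * (f x * g z))
        = (case p of (s, u, v) \<Rightarrow> ?w (s \<union> (u \<union> v)) * (f (s \<union> u) * g (s \<union> v)))"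
      using fs by (auto simp: p)
  next
    fix q assume "q \<in> (SIGMA x:?F. {z \<in> ?F. x \<union> z \<in> faces X (Suc (Suc r))})"
    then obtain x z where q: "q = (x, z)" and x: "x \<in> ?F" and z: "z \<in> ?F"
      and xz: "x \<union> z \<in> faces X (Suc (Suc r))" by auto
    have parts: "x \<inter> z \<union> (x - z) = x" "x \<inter> z \<union> (z - x) = z" "x \<inter> z \<union> (x - z \<union> (z - x)) = x \<union> z"
      by auto
    then show "(case case q of (x, z) \<Rightarrow> (x \<inter> z, x - z, z - x) of (s, u, v) \<Rightarrow> (s \<union> u, s \<union> v)) = q"
      by (simp add: q)
    have "card (x \<inter> z) = r"
      using card_Un_Int[of x z] face(1,2)[OF x] face(1,2)[OF z] face(2)[OF xz] by simp
    then have s: "x \<inter> z \<in> faces X r" using face_subset[OF x, of "x \<inter> z" r] by simp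
    show "(case q of (x, z) \<Rightarrow> (x \<inter> z, x - z, z - x)) \<in> (SIGMA s:faces X r. SIGMA u:?A s. ?B s u)"
      using s x z xz parts by (auto simp: q faces_link[OF s])
  qed
  also have "\<dots> = pair_sum X (Suc r) f g"
    by (simp add: pair_sum_def sum.Sigma)
  finally have eq: "pair_sum X (Suc r) f g
    = (\<Sum>s\<in>faces X r. \<Sum>u\<in>?A s. \<Sum>v\<in>?B s u. ?w (s \<union> (u \<union> v)) * (f (s \<union> u) * g (s \<union> v)))" ..
  show ?thesis
    unfolding eq sum_divide_distrib[of _ "faces X r"]
    by (intro sum.cong refl) (simp only: inner_walk_link[OF _ r])
qed

subsection \<open>Approximate diagonalisation\<close>

lemma garland:
  assumes exp: "two_sided_local_expander X \<gamma>" and r: "r + 2 \<le> cdim X"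
  shows "\<bar>inner_lev X (Suc (Suc r)) (up X (Suc r) f) (up X (Suc r) g)
            - inner_lev X (Suc r) f g / real (r + 2)
            - real (r + 1) / real (r + 2) * inner_lev X r (down X (Suc r) f) (down X (Suc r) g)\<bar>
           \<le> \<gamma> * (norm_lev X (Suc r) f * norm_lev X (Suc r) g)"
proof -
  define loc where "loc = (\<lambda>(a :: nat set \<Rightarrow> real) s t. a (s \<union> t))"
  define N where "N = (\<lambda>a s. norm_lev (link X s) 1 (loc a s))"
  define W where "W = (\<lambda>s. inner_lev (link X s) 1 (loc f s) (walk (link X s) (loc g s)))"
  define E where "E = (\<lambda>a s. down X (Suc r) a s)"
  have \<gamma>: "0 \<le> \<gamma>" using exp by (simp add: two_sided_local_expander_def)
  have E_link: "E a s = expect (link X s) 1 (loc a s)" if "s \<in> faces X r" for a s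
    using expect_link[OF that, of a] by (simp add: E_def loc_def)
  have N_E: "N a s * N a s = E (\<lambda>x. a x * a x) s" if s: "s \<in> faces X r" for a s
  proof -
    interpret L: weighted_complex n "link X s" by (rule weighted_complex_link) fact
    have "N a s * N a s = inner_lev (link X s) 1 (loc a s) (loc a s)"
      using L.norm_sq[of 1 "loc a s"] by (simp add: N_def power2_eq_square)
    then show ?thesis by (simp add: E_link[OF s] inner_lev_def loc_def)
  qed
  have norm_N: "norm_lev X r (N a) = norm_lev X (Suc r) a" for a
  proof -
    have "inner_lev X r (N a) (N a) = expect X r (E (\<lambda>x. a x * a x))"
      unfolding inner_lev_def by (intro expect_cong) (simp add: N_E)
    also have "\<dots> = expect X (Suc r) (\<lambda>x. a x * a x)"
      unfolding E_def using r by (intro expect_down) simp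
    finally show ?thesis by (simp add: norm_lev_def inner_lev_def)
  qed
  have local: "\<bar>W s - E f s * E g s\<bar> \<le> \<gamma> * (N f s * N g s)" if s: "s \<in> faces X r" for s
  proof -
    interpret L: weighted_complex n "link X s" by (rule weighted_complex_link) fact
    have "2 \<le> cdim (link X s)" using r face(2)[OF s] by (simp add: cdim_link)
    moreover have "\<bar>\<mu>\<bar> \<le> \<gamma>" if "nontrivial_eigenvalue (link X s) \<mu>" for \<mu>
      using exp s r that by (auto simp: two_sided_local_expander_def)
    ultimately show ?thesis
      unfolding W_def N_def E_link[OF s] using \<gamma> by (intro L.walk_near_expectation)
  qed
  have "\<bar>expect X r W - inner_lev X r (E f) (E g)\<bar>
      = \<bar>\<Sum>s\<in>faces X r. level_wt X r s * (W s - E f s * E g s)\<bar>"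
    by (simp add: inner_lev_def expect_def right_diff_distrib sum_subtractf)
  also have "\<dots> \<le> (\<Sum>s\<in>faces X r. level_wt X r s * (\<gamma> * (N f s * N g s)))"
    by (rule order_trans[OF sum_abs], rule sum_mono)
      (simp add: abs_mult abs_of_pos level_wt_pos local)
  also have "\<dots> = \<gamma> * inner_lev X r (N f) (N g)"
    by (simp add: inner_lev_def expect_def sum_distrib_left mult_ac)
  also have "\<dots> \<le> \<gamma> * (norm_lev X (Suc r) f * norm_lev X (Suc r) g)"
    using inner_le_norm[of r "N f" "N g"] \<gamma> by (intro mult_left_mono) (simp_all add: norm_N)
  finally have main: "\<bar>expect X r W - inner_lev X r (E f) (E g)\<bar>
      \<le> \<gamma> * (norm_lev X (Suc r) f * norm_lev X (Suc r) g)" .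
  have "inner_lev X (Suc (Suc r)) (up X (Suc r) f) (up X (Suc r) g)
      = inner_lev X (Suc r) f g / real (r + 2) + pair_sum X (Suc r) f g / (real (r + 2))\<^sup>2"
    using inner_up_up[of "Suc r" f g] r by simp
  also have "pair_sum X (Suc r) f g / (real (r + 2))\<^sup>2
      = real (r + 1) / real (r + 2) * (pair_sum X (Suc r) f g / (real (r + 1) * real (r + 2)))"
    by (simp add: power2_eq_square del: of_nat_add of_nat_Suc)
  also have "pair_sum X (Suc r) f g / (real (r + 1) * real (r + 2)) = expect X r W"
    unfolding pair_sum_links[OF r] by (simp add: expect_def W_def loc_def)
  finally have "inner_lev X (Suc (Suc r)) (up X (Suc r) f) (up X (Suc r) g)
      - inner_lev X (Suc r) f g / real (r + 2) - real (r + 1) / real (r + 2) * inner_lev X r (E f) (E g)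
      = real (r + 1) / real (r + 2) * (expect X r W - inner_lev X r (E f) (E g))"
    by (simp add: right_diff_distrib)
  then have "\<bar>inner_lev X (Suc (Suc r)) (up X (Suc r) f) (up X (Suc r) g)
      - inner_lev X (Suc r) f g / real (r + 2) - real (r + 1) / real (r + 2) * inner_lev X r (E f) (E g)\<bar>
      = real (r + 1) / real (r + 2) * \<bar>expect X r W - inner_lev X r (E f) (E g)\<bar>"
    by (simp add: abs_mult)
  also have "\<dots> \<le> 1 * \<bar>expect X r W - inner_lev X r (E f) (E g)\<bar>"
    by (intro mult_right_mono) auto
  finally show ?thesis using main by (simp add: E_def)
qed

lemma H_space_orthogonal:
  assumes "h \<in> H_space X j" "i < j" "j \<le> cdim X"
  shows "inner_lev X j (up_iter X i j u) h = 0"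
proof -
  obtain r where j: "j = Suc r" using assms(2) by (cases j) auto
  have "inner_lev X j (up_iter X i j u) h = inner_lev X r (up_iter X i r u) (down X (Suc r) h)"
    using assms by (simp add: j up_down_adjoint)
  also have "\<dots> = 0"
    using assms(1) by (simp add: inner_lev_def expect_def H_space_def j)
  finally show ?thesis .
qed

lemma expect_H_space:
  assumes "h \<in> H_space X j" "1 \<le> j" "j \<le> cdim X"
  shows "expect X j h = 0"
proof -
  obtain r where j: "j = Suc r" using assms(2) by (cases j) auto
  have "expect X j h = expect X r (down X (Suc r) h)"
    using assms by (simp add: j expect_down)
  also have "\<dots> = 0" using assms(1) by (simp add: expect_def H_space_def j)
  finally show ?thesis .
qed

lemma inner_up_up_iter:
  assumes exp: "two_sided_local_expander X \<gamma>" and h: "h \<in> H_space X l"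
    and "l \<le> m" "m < cdim X"
  shows "\<bar>inner_lev X (Suc m) (up_iter X l (Suc m) h) (up X m g)
            - real (Suc m - l) / real (Suc m) * inner_lev X m (up_iter X l m h) g\<bar>
           \<le> real (Suc m) * \<gamma> * (norm_lev X l h * norm_lev X m g)"
  using assms(3,4)
proof (induction m arbitrary: g rule: dec_induct)
  case base
  have \<gamma>: "0 \<le> \<gamma>" using exp by (simp add: two_sided_local_expander_def)
  show ?case
  proof (cases l)
    case 0
    have "{z \<in> faces X 0. x \<union> z \<in> faces X (Suc 0)} = {}" if "x \<in> faces X 0" for x
      using that face(2)[of "{}" "Suc 0"] by (auto simp: faces_0)
    then have "pair_sum X 0 h g = 0"
      unfolding pair_sum_def by (intro sum.neutral ballI) (simp only: empty_iff)
    then show ?thesis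
      using inner_up_up[of 0 h g] base \<gamma> norm_nonneg by (simp add: 0)
  next
    case (Suc r)
    have "inner_lev X r (down X (Suc r) h) (down X (Suc r) g) = 0"
      using h by (simp add: inner_lev_def expect_def H_space_def Suc)
    then have "\<bar>inner_lev X (Suc l) (up X l h) (up X l g) - inner_lev X l h g / real (Suc l)\<bar>
        \<le> 1 * \<gamma> * (norm_lev X l h * norm_lev X l g)"
      using garland[OF exp, of r h g] base by (simp add: Suc)
    also have "\<dots> \<le> real (Suc l) * \<gamma> * (norm_lev X l h * norm_lev X l g)"
      using \<gamma> norm_nonneg by (intro mult_right_mono mult_nonneg_nonneg) auto
    finally show ?thesis by simp
  qed
next
  case (step r)
  have \<gamma>: "0 \<le> \<gamma>" using exp by (simp add: two_sided_local_expander_def)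
  define F where "F = up_iter X l (Suc r) h"
  define d where "d = down X (Suc r) g"
  have F: "F = up X r (up_iter X l r h)" using step by (simp add: F_def)
  have r: "r < cdim X" using step by simp
  let ?m = "real (r + 1)" and ?M = "real (r + 2)"
  define A where "A = inner_lev X (Suc (Suc r)) (up X (Suc r) F) (up X (Suc r) g)"
  define B where "B = inner_lev X (Suc r) F (up X r d)"
  define C where "C = inner_lev X (Suc r) F g"
  define Nh where "Nh = norm_lev X l h"
  define Ng where "Ng = norm_lev X (Suc r) g"
  have N0: "0 \<le> Nh" "0 \<le> Ng" by (simp_all add: Nh_def Ng_def norm_nonneg)
  have "inner_lev X r (down X (Suc r) F) (down X (Suc r) g) = B"
    using up_down_adjoint[OF r, of d F] by (simp add: B_def d_def inner_sym)
  then have "\<bar>A - C / ?M - ?m / ?M * B\<bar> \<le> \<gamma> * (norm_lev X (Suc r) F * Ng)"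
    using garland[OF exp, of r F g] step.prems by (simp add: A_def C_def Ng_def)
  also have "\<dots> \<le> \<gamma> * (Nh * Ng)"
    unfolding F_def Nh_def using step \<gamma> N0
    by (intro mult_left_mono mult_right_mono norm_up_iter_le) auto
  finally have e1: "\<bar>A - C / ?M - ?m / ?M * B\<bar> \<le> \<gamma> * (Nh * Ng)" .
  have "inner_lev X r (up_iter X l r h) d = C"
    using up_down_adjoint[OF r, of "up_iter X l r h" g] by (simp add: C_def d_def F)
  then have "\<bar>B - real (Suc r - l) / ?m * C\<bar> \<le> ?m * \<gamma> * (Nh * norm_lev X r d)"
    using step.IH[OF r, of d] by (simp add: B_def F_def Nh_def)
  also have "\<dots> \<le> ?m * \<gamma> * (Nh * Ng)"
    unfolding d_def Ng_def using norm_down_le[OF r] \<gamma> N0 by (intro mult_left_mono) auto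
  finally have e2: "\<bar>B - real (Suc r - l) / ?m * C\<bar> \<le> ?m * \<gamma> * (Nh * Ng)" .
  have "A - real (Suc (Suc r) - l) / ?M * C
      = (A - C / ?M - ?m / ?M * B) + ?m / ?M * (B - real (Suc r - l) / ?m * C)"
  proof -
    have "real (Suc (Suc r) - l) = 1 + real (Suc r - l)" using step by simp
    moreover have "?m / ?M * (real (Suc r - l) / ?m * C) = real (Suc r - l) / ?M * C" by simp
    ultimately show ?thesis by (simp only: right_diff_distrib add_divide_distrib distrib_right) simp
  qed
  also have "\<bar>\<dots>\<bar> \<le> \<bar>A - C / ?M - ?m / ?M * B\<bar> + 1 * \<bar>B - real (Suc r - l) / ?m * C\<bar>"
  proof -
    have "\<bar>?m / ?M * (B - real (Suc r - l) / ?m * C)\<bar> = ?m / ?M * \<bar>B - real (Suc r - l) / ?m * C\<bar>"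
      by (simp only: abs_mult) simp
    also have "\<dots> \<le> 1 * \<bar>B - real (Suc r - l) / ?m * C\<bar>"
      by (intro mult_right_mono) auto
    finally show ?thesis
      using abs_triangle_ineq[of "A - C / ?M - ?m / ?M * B" "?m / ?M * (B - real (Suc r - l) / ?m * C)"]
      by linarith
  qed
  also have "\<dots> \<le> \<gamma> * (Nh * Ng) + ?m * \<gamma> * (Nh * Ng)"
    using add_mono[OF e1 e2] by (simp only: mult_1_left)
  also have "\<dots> = ?M * \<gamma> * (Nh * Ng)" by (simp add: algebra_simps)
  finally show ?case
    using step by (simp add: A_def C_def F_def Nh_def Ng_def)
qed

lemma inner_up_iter_up_iter:
  assumes exp: "two_sided_local_expander X \<gamma>" and h: "h \<in> H_space X l"
    and "l \<le> i" "i \<le> k" "k \<le> cdim X"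
  shows "\<bar>inner_lev X k (up_iter X l k h) (up_iter X i k g)
            - real (i choose l) / real (k choose l) * inner_lev X i (up_iter X l i h) g\<bar>
           \<le> (real k)\<^sup>2 * \<gamma> * (norm_lev X l h * norm_lev X i g)"
  using assms(4,5)
proof (induction k rule: dec_induct)
  case base
  have "0 \<le> \<gamma>" using exp by (simp add: two_sided_local_expander_def)
  then show ?case using assms(3) norm_nonneg by simp
next
  case (step k)
  have \<gamma>: "0 \<le> \<gamma>" using exp by (simp add: two_sided_local_expander_def)
  have lk: "l \<le> k" using assms(3) step by simp
  define A where "A = inner_lev X (Suc k) (up_iter X l (Suc k) h) (up X k (up_iter X i k g))"
  define B where "B = inner_lev X k (up_iter X l k h) (up_iter X i k g)"
  define C where "C = inner_lev X i (up_iter X l i h) g"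
  define a where "a = real (Suc k - l) / real (Suc k)"
  define b where "b = real (i choose l) / real (k choose l)"
  define P where "P = \<gamma> * (norm_lev X l h * norm_lev X i g)"
  have P0: "0 \<le> P" using \<gamma> norm_nonneg by (simp add: P_def)
  have "\<bar>A - a * B\<bar> \<le> real (Suc k) * \<gamma> * (norm_lev X l h * norm_lev X k (up_iter X i k g))"
    unfolding A_def B_def a_def using step lk by (intro inner_up_up_iter[OF exp h]) auto
  also have "\<dots> \<le> real (Suc k) * \<gamma> * (norm_lev X l h * norm_lev X i g)"
    using step \<gamma> norm_nonneg by (intro mult_left_mono norm_up_iter_le) auto
  finally have e1: "\<bar>A - a * B\<bar> \<le> real (Suc k) * P" by (simp add: P_def mult.assoc)
  have e2: "\<bar>B - b * C\<bar> \<le> (real k)\<^sup>2 * P"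
    using step.IH step.prems by (simp add: B_def b_def C_def P_def mult.assoc)
  have a: "0 \<le> a" "a \<le> 1" by (auto simp: a_def)
  have ab: "a * b = real (i choose l) / real (Suc k choose l)"
  proof -
    have "(Suc k - l) * (Suc k choose l) = Suc k * (k choose l)"
      using binomial_absorb_comp[of "Suc k" l] by simp
    then have "real (Suc k - l) * real (Suc k choose l) = real (Suc k) * real (k choose l)"
      by (metis of_nat_mult)
    moreover have "real (Suc k choose l) > 0" "real (k choose l) > 0" using lk by auto
    ultimately show ?thesis
      by (simp add: a_def b_def divide_simps mult_ac del: of_nat_Suc of_nat_add binomial_Suc_Suc)
  qed
  have "\<bar>A - a * b * C\<bar> \<le> \<bar>A - a * B\<bar> + \<bar>a * (B - b * C)\<bar>"
    using abs_triangle_ineq[of "A - a * B" "a * (B - b * C)"] by (simp add: algebra_simps)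
  also have "\<bar>a * (B - b * C)\<bar> \<le> 1 * \<bar>B - b * C\<bar>"
    unfolding abs_mult using a by (intro mult_right_mono) auto
  also have "\<bar>A - a * B\<bar> + 1 * \<bar>B - b * C\<bar> \<le> (real (Suc k) + (real k)\<^sup>2) * P"
    using e1 e2 by (simp add: distrib_right)
  also have "\<dots> \<le> (real (Suc k))\<^sup>2 * P"
    using P0 by (intro mult_right_mono) (auto simp: power2_eq_square algebra_simps)
  finally show ?case
    using step unfolding ab by (simp add: A_def C_def P_def mult.assoc)
qed

lemma expect_up_iter:
  "\<lbrakk>l \<le> k; k \<le> cdim X\<rbrakk> \<Longrightarrow> expect X k (up_iter X l k f) = expect X l f"
proof (induction k)
  case (Suc k)
  then show ?case by (cases "l = Suc k") (auto simp: expect_up)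
qed simp

lemma up_iter_indicator:
  assumes s: "s \<in> faces X i" and "i \<le> k" "k \<le> cdim X" "y \<in> faces X k"
  shows "up_iter X i k (indicator {s}) y = (if s \<subseteq> y then 1 / real (k choose i) else 0)"
  using assms(2-4)
proof (induction k arbitrary: y rule: dec_induct)
  case base
  have "s \<subseteq> y \<longleftrightarrow> y = s"
    using card_subset_eq[of y s] face(1,2)[OF base(2)] face(2)[OF s] by auto
  then show ?case by (simp add: indicator_def)
next
  case (step k)
  have fy: "finite y" "card y = Suc k" using face[OF step.prems(2)] by auto
  let ?A = "{x \<in> faces X k. x \<subset> y}"
  have "up_iter X i (Suc k) (indicator {s}) y
      = 1 / real (k + 1) * (\<Sum>x\<in>?A. if s \<subseteq> x then 1 / real (k choose i) else 0)"
    using step by (simp add: up_def)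
  also have "(\<Sum>x\<in>?A. if s \<subseteq> x then 1 / real (k choose i) else 0)
      = (\<Sum>x | x \<in> ?A \<and> s \<subseteq> x. 1 / real (k choose i))"
    by (rule sum.inter_filter[symmetric]) simp
  also have "\<dots> = (if s \<subseteq> y then real (Suc k - i) else 0) / real (k choose i)"
  proof (cases "s \<subseteq> y")
    case True
    have "{x. x \<in> ?A \<and> s \<subseteq> x} = {x. s \<subseteq> x \<and> x \<subset> y \<and> Suc (card x) = card y}"
      using subfaces[OF step.prems(2)] by blast
    then have "card {x. x \<in> ?A \<and> s \<subseteq> x} = Suc k - i"
      using card_subsets_one_smaller[OF fy(1) True] fy True face(1,2)[OF s]
      by (simp add: card_Diff_subset)
    then show ?thesis using True by simp
  next
    case False
    then have "{x. x \<in> ?A \<and> s \<subseteq> x} = {}" by auto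
    then show ?thesis using False by (simp only: sum.empty if_False div_0)
  qed
  also have "1 / real (k + 1) * \<dots> = (if s \<subseteq> y then 1 / real (Suc k choose i) else 0)"
  proof -
    have "(Suc k - i) * (Suc k choose i) = Suc k * (k choose i)"
      using binomial_absorb_comp[of "Suc k" i] by simp
    then have "real (Suc k - i) * real (Suc k choose i) = real (Suc k) * real (k choose i)"
      by (metis of_nat_mult)
    moreover have "real (Suc k choose i) > 0" "real (k choose i) > 0" using step by auto
    ultimately show ?thesis
      by (simp add: divide_simps mult_ac del: of_nat_Suc of_nat_add binomial_Suc_Suc)
  qed
  finally show ?case .
qed

lemma down_iter_local_expect:
  assumes s: "s \<in> faces X i" and ik: "i \<le> k" "k \<le> cdim X"
  shows "local_expect X k s f = down_iter X i k f s"
proof -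
  have w: "level_wt X i s > 0" using s by (rule level_wt_pos)
  have ind: "expect X i (\<lambda>x. indicator {s} x * a x) = level_wt X i s * a s" for a
    unfolding expect_def using s
    by (subst sum.remove[OF finite_faces s]) (simp add: indicator_def)
  have up: "expect X k (\<lambda>y. up_iter X i k (indicator {s}) y * a y)
      = (\<Sum>y | y \<in> faces X k \<and> s \<subseteq> y. level_wt X k y * a y) / real (k choose i)" for a
  proof -
    have "expect X k (\<lambda>y. up_iter X i k (indicator {s}) y * a y)
        = (\<Sum>y\<in>faces X k. if s \<subseteq> y then level_wt X k y * a y / real (k choose i) else 0)"
      unfolding expect_def
      by (intro sum.cong refl) (simp add: up_iter_indicator[OF s ik])
    also have "\<dots> = (\<Sum>y | y \<in> faces X k \<and> s \<subseteq> y. level_wt X k y * a y / real (k choose i))"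
      by (rule sum.inter_filter[symmetric]) simp
    finally show ?thesis by (simp only: sum_divide_distrib)
  qed
  have "(\<Sum>y | y \<in> faces X k \<and> s \<subseteq> y. level_wt X k y * f y) / real (k choose i)
      = level_wt X i s * down_iter X i k f s"
    using up_iter_down_iter_adjoint[OF ik, of "indicator {s}" f] up[of f] ind[of "down_iter X i k f"]
    by (simp add: inner_lev_def)
  moreover have "(\<Sum>y | y \<in> faces X k \<and> s \<subseteq> y. level_wt X k y) / real (k choose i) = level_wt X i s"
    using expect_up_iter[OF ik, of "indicator {s}"] up[of "\<lambda>_. 1"] ind[of "\<lambda>_. 1"] by simp
  moreover have "real (k choose i) > 0" using ik by simp
  ultimately show ?thesis
    using w unfolding local_expect_def by (simp add: field_simps)
qed

lemma linf_norm_leD: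
  assumes "linf_norm X k f \<le> e" "x \<in> faces X k"
  shows "\<bar>f x\<bar> \<le> e"
proof -
  have "\<bar>f x\<bar> \<le> linf_norm X k f"
    unfolding linf_norm_def using assms(2) by (intro Max_ge) auto
  then show ?thesis using assms(1) by simp
qed

lemma level_projection_bound:
  assumes exp: "two_sided_local_expander X \<gamma>" and k: "k \<le> cdim X" and i: "1 \<le> i" "i \<le> k"
    and h: "\<And>j. j \<le> k \<Longrightarrow> h j \<in> H_space X j"
    and f: "\<And>y. y \<in> faces X k \<Longrightarrow> f y = (\<Sum>j\<le>k. up_iter X j k (h j) y)"
    and \<gamma>: "\<gamma> \<le> 2 powr (- (6 * real k))"
    and G: "G = inner_lev X i (\<lambda>s. down_iter X i k f s - expect X k f)
                              (\<lambda>s. down_iter X i k f s - expect X k f)"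
  shows "\<bar>inner_lev X k f (up_iter X i k (h i))\<bar>
           \<le> real (k choose i) * G + 2 powr (5 * real k) * \<gamma> * (norm_lev X k f)\<^sup>2"
proof -
  define F where "F = (\<lambda>j. up_iter X j k (h j))"
  define N where "N = (\<lambda>j. norm_lev X j (h j))"
  define c where "c = (real k)\<^sup>2 * \<gamma>"
  define S where "S = (\<Sum>j\<le>k. (N j)\<^sup>2)"
  have \<gamma>0: "0 \<le> \<gamma>" using exp by (simp add: two_sided_local_expander_def)
  have c0: "0 \<le> c" using \<gamma>0 by (simp add: c_def)
  have N0: "0 \<le> N j" for j by (simp add: N_def norm_nonneg)
  have S0: "0 \<le> S" by (simp add: S_def sum_nonneg)
  have off_lt: "\<bar>inner_lev X k (F a) (F b)\<bar> \<le> c * (N a * N b)" if "a < b" "b \<le> k" for a b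
    using inner_up_iter_up_iter[OF exp h[of a], of b k "h b"] H_space_orthogonal[OF h[of b], of a "h a"] that k
    by (simp add: F_def c_def N_def)
  have off: "\<bar>inner_lev X k (F a) (F b)\<bar> \<le> c * (N a * N b)" if "a \<noteq> b" "a \<le> k" "b \<le> k" for a b
    using off_lt[of a b] off_lt[of b a] that inner_sym[of k "F a" "F b"]
    by (cases "a < b") (auto simp: mult_ac)
  have diag: "\<bar>inner_lev X k (F a) (F a) - (N a)\<^sup>2 / real (k choose a)\<bar> \<le> c * (N a * N a)" if "a \<le> k" for a
    using inner_up_iter_up_iter[OF exp h[of a], of a k "h a"] that k norm_sq[of a "h a"]
    by (simp add: F_def c_def N_def)
  have NN: "N a * N b \<le> S" if "a \<le> k" "b \<le> k" for a b
  proof -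
    have "(N j)\<^sup>2 \<le> S" if "j \<le> k" for j
      unfolding S_def by (rule member_le_sum) (use that in auto)
    then have "(N a)\<^sup>2 + (N b)\<^sup>2 \<le> S + S" using that by (intro add_mono) auto
    moreover have "2 * (N a * N b) \<le> (N a)\<^sup>2 + (N b)\<^sup>2" using sum_squares_bound[of "N a" "N b"] by simp
    ultimately show ?thesis by linarith
  qed
  have f_F: "inner_lev X k f (F a) = (\<Sum>j\<le>k. inner_lev X k (F j) (F a))" for a
    unfolding inner_sum_left[symmetric] by (intro inner_cong) (simp_all add: f F_def)
  have near: "\<bar>inner_lev X k f (F a) - (N a)\<^sup>2 / real (k choose a)\<bar> \<le> real (k + 1) * c * S" if a: "a \<le> k" for a
  proof -
    have "inner_lev X k f (F a) - (N a)\<^sup>2 / real (k choose a)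
        = (\<Sum>j\<le>k. inner_lev X k (F j) (F a) - (if j = a then (N a)\<^sup>2 / real (k choose a) else 0))"
      using a by (simp add: f_F sum_subtractf)
    also have "\<bar>\<dots>\<bar> \<le> (\<Sum>j\<le>k. c * S)"
    proof (rule order_trans[OF sum_abs], rule sum_mono)
      fix j assume j: "j \<in> {..k}"
      have "\<bar>inner_lev X k (F j) (F a) - (if j = a then (N a)\<^sup>2 / real (k choose a) else 0)\<bar>
              \<le> c * (N j * N a)"
        using off[of j a] diag[OF a] j a by simp
      also have "\<dots> \<le> c * S" using NN[of j a] j a c0 by (intro mult_left_mono) auto
      finally show "\<bar>inner_lev X k (F j) (F a) - (if j = a then (N a)\<^sup>2 / real (k choose a) else 0)\<bar>
              \<le> c * S" .
    qed
    finally show ?thesis by simp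
  qed
  have pow: "real k \<le> 2 ^ k" "real (k + 1) \<le> 2 ^ k"
  proof -
    have "k + 1 \<le> 2 ^ k" by (simp only: Suc_eq_plus1[symmetric] Suc_le_eq less_exp)
    then have "real (k + 1) \<le> real (2 ^ k)" by (simp only: of_nat_le_iff)
    then show "real (k + 1) \<le> 2 ^ k" "real k \<le> 2 ^ k" by simp_all
  qed
  have \<gamma>_pow: "\<gamma> * 2 ^ (6 * k) \<le> 1"
  proof -
    have "\<gamma> \<le> 1 / 2 ^ (6 * k)"
      using \<gamma> by (simp add: powr_minus divide_inverse powr_realpow[of 2 "6 * k", simplified, symmetric])
    then show ?thesis by (simp add: field_simps)
  qed
  have kc: "real (k + 1) * c \<le> 2 ^ (3 * k) * \<gamma>"
  proof -
    have "real (k + 1) * (real k * real k) \<le> 2 ^ k * (2 ^ k * 2 ^ k)"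
      using pow by (intro mult_mono) auto
    also have "\<dots> = 2 ^ (k + (k + k))" by (simp only: power_add)
    also have "k + (k + k) = 3 * k" by simp
    finally have "real (k + 1) * (real k * real k) * \<gamma> \<le> 2 ^ (3 * k) * \<gamma>"
      by (rule mult_right_mono) (rule \<gamma>0)
    then show ?thesis by (simp add: c_def power2_eq_square mult_ac)
  qed
  have S_le: "S \<le> 2 ^ (k + 1) * (norm_lev X k f)\<^sup>2"
  proof -
    have "S / 2 ^ k - 2 ^ (4 * k) * \<gamma> * S \<le> (\<Sum>a\<le>k. inner_lev X k f (F a))"
    proof -
      have "S / 2 ^ k - real (k + 1) * (real (k + 1) * c * S)
          = (\<Sum>a\<le>k. (N a)\<^sup>2 / 2 ^ k - real (k + 1) * c * S)"
        by (simp add: S_def sum_subtractf sum_divide_distrib)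
      also have "\<dots> \<le> (\<Sum>a\<le>k. inner_lev X k f (F a))"
      proof (rule sum_mono)
        fix a assume a: "a \<in> {..k}"
        have "real (k choose a) \<le> real (2 ^ k)" using binomial_le_pow2 by (simp only: of_nat_le_iff)
        then have "(N a)\<^sup>2 / 2 ^ k \<le> (N a)\<^sup>2 / real (k choose a)"
          using a by (intro divide_left_mono) auto
        then show "(N a)\<^sup>2 / 2 ^ k - real (k + 1) * c * S \<le> inner_lev X k f (F a)"
          using near[of a] a by simp
      qed
      finally have "S / 2 ^ k - real (k + 1) * (real (k + 1) * c * S)
          \<le> (\<Sum>a\<le>k. inner_lev X k f (F a))" .
      moreover have "real (k + 1) * (real (k + 1) * c * S) \<le> 2 ^ (4 * k) * \<gamma> * S"
      proof -
        have "real (k + 1) * (real (k + 1) * c) \<le> 2 ^ k * (2 ^ (3 * k) * \<gamma>)"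
          by (rule mult_mono[OF pow(2) kc]) (use c0 in simp_all)
        also have "\<dots> = 2 ^ (4 * k) * \<gamma>" by (simp flip: power_add mult.assoc)
        finally have "real (k + 1) * (real (k + 1) * c) * S \<le> 2 ^ (4 * k) * \<gamma> * S"
          by (rule mult_right_mono) (rule S0)
        then show ?thesis by (simp only: mult.assoc)
      qed
      ultimately show ?thesis by linarith
    qed
    also have "(\<Sum>a\<le>k. inner_lev X k f (F a)) = (norm_lev X k f)\<^sup>2"
      unfolding norm_sq inner_sum_right[symmetric] by (intro inner_cong) (simp_all add: f F_def)
    finally have "S / 2 ^ k - 2 ^ (4 * k) * \<gamma> * S \<le> (norm_lev X k f)\<^sup>2" .
    then have "2 ^ (k + 1) * (S / 2 ^ k - 2 ^ (4 * k) * \<gamma> * S) \<le> 2 ^ (k + 1) * (norm_lev X k f)\<^sup>2"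
      by (rule mult_left_mono) simp
    moreover have "2 ^ (k + 1) * (S / 2 ^ k - 2 ^ (4 * k) * \<gamma> * S) = 2 * S - (2 ^ (5 * k + 1) * \<gamma>) * S"
      by (simp add: right_diff_distrib power_add flip: power_mult) (simp add: mult_ac flip: power_add)
    moreover have "(2 ^ (5 * k + 1) * \<gamma>) * S \<le> 1 * S"
    proof (rule mult_right_mono)
      have "(2::real) ^ (5 * k + 1) \<le> 2 ^ (6 * k)" using i by (intro power_increasing) auto
      then have "2 ^ (5 * k + 1) * \<gamma> \<le> 2 ^ (6 * k) * \<gamma>" using \<gamma>0 by (rule mult_right_mono)
      then show "2 ^ (5 * k + 1) * \<gamma> \<le> 1" using \<gamma>_pow by (simp add: mult.commute)
    qed (rule S0)
    ultimately show ?thesis by linarith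
  qed
  define B where "B = real (k choose i)"
  define s where "s = inner_lev X k f (F i)"
  define e where "e = 2 powr (5 * real k) * \<gamma> * (norm_lev X k f)\<^sup>2"
  have B: "B > 0" using i by (simp add: B_def)
  have e: "\<bar>s - (N i)\<^sup>2 / B\<bar> \<le> e"
  proof -
    have "\<bar>s - (N i)\<^sup>2 / B\<bar> \<le> real (k + 1) * c * S" using near[of i] i by (simp add: s_def B_def)
    also have "\<dots> \<le> (2 ^ (3 * k) * \<gamma>) * (2 ^ (k + 1) * (norm_lev X k f)\<^sup>2)"
      by (rule mult_mono[OF kc S_le]) (use S0 \<gamma>0 in simp_all)
    also have "\<dots> = 2 ^ (4 * k + 1) * \<gamma> * (norm_lev X k f)\<^sup>2"
      by (simp add: power_add mult_ac) (simp flip: power_add mult.assoc)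
    also have "\<dots> \<le> 2 ^ (5 * k) * \<gamma> * (norm_lev X k f)\<^sup>2"
      using i \<gamma>0 by (intro mult_right_mono power_increasing) auto
    also have "\<dots> = e"
      using powr_realpow[of 2 "5 * k"] by (simp add: e_def)
    finally show ?thesis .
  qed
  have s_sq: "s\<^sup>2 \<le> G * (N i)\<^sup>2"
  proof -
    let ?D = "down_iter X i k f"
    have ik: "i \<le> k" "i \<le> cdim X" using i k by auto
    have "s = inner_lev X i ?D (h i)"
      unfolding s_def F_def using up_iter_down_iter_adjoint[OF ik(1) k] by (simp add: inner_sym)
    also have "\<dots> = inner_lev X i (\<lambda>s. ?D s - expect X k f) (h i)"
      unfolding inner_diff_left inner_const_left using expect_H_space[OF h[OF ik(1)] i(1) ik(2)] by simp
    finally show ?thesis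
      using inner_sq_le[of i "\<lambda>s. ?D s - expect X k f" "h i"] by (simp add: G N_def norm_sq)
  qed
  have e0: "0 \<le> e" using e by linarith
  have G0: "0 \<le> G" unfolding G by (rule inner_nonneg)
  have "\<bar>s\<bar> \<le> B * G + e"
  proof (cases "s \<le> 0")
    case True
    have "0 \<le> (N i)\<^sup>2 / B" using B by simp
    then have "\<bar>s\<bar> \<le> e" using True e by linarith
    then show ?thesis using B G0 by (simp add: add_increasing)
  next
    case False
    have "(N i)\<^sup>2 / B \<le> s + e" using e by linarith
    then have "(N i)\<^sup>2 \<le> B * (s + e)" using B by (simp add: field_simps)
    then have "s\<^sup>2 \<le> G * (B * (s + e))"
      using s_sq G0 by (meson mult_left_mono order_trans)
    then have *: "s * s \<le> (B * G) * (s + e)" by (simp add: power2_eq_square mult_ac)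
    show ?thesis
    proof (rule ccontr)
      assume "\<not> ?thesis"
      then have s: "s > B * G + e" using False by simp
      have BG: "0 \<le> B * G" using B G0 by simp
      have "(B * G) * (s + e) = (B * G) * s + (B * G) * e" by (simp add: distrib_left)
      also have "\<dots> \<le> (B * G) * s + s * e"
        using s BG e0 by (intro add_left_mono mult_right_mono) auto
      also have "\<dots> = s * (B * G + e)" by (simp add: algebra_simps)
      also have "\<dots> < s * s" using s False by (intro mult_strict_left_mono) auto
      finally show False using * by simp
    qed
  qed
  then show ?thesis by (simp add: s_def F_def B_def e_def)
qed

lemma pseudorandom_deviation:
  assumes "i \<le> k" "k \<le> cdim X"
    and linf: "linf_norm X i (\<lambda>s. down_iter X i k f s - expect X k f) \<le> e"
  defines "g \<equiv> \<lambda>s. down_iter X i k f s - expect X k f"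
  shows "inner_lev X i g g \<le> e\<^sup>2"
    and "local_constant_sign X k i f \<Longrightarrow> inner_lev X i g g \<le> e * \<bar>expect X k f\<bar>"
proof -
  have i: "i \<le> cdim X" using assms by simp
  have g: "\<bar>g s\<bar> \<le> e" if "s \<in> faces X i" for s
    using linf_norm_leD[OF linf that] by (simp add: g_def)
  have "inner_lev X i g g \<le> expect X i (\<lambda>_. e\<^sup>2 * 1)"
    unfolding inner_lev_def
  proof (rule expect_mono)
    fix s assume "s \<in> faces X i"
    then have "\<bar>g s\<bar>\<^sup>2 \<le> e\<^sup>2" by (intro power_mono g) auto
    then show "g s * g s \<le> e\<^sup>2 * 1" by (simp add: power2_eq_square)
  qed
  also have "\<dots> = e\<^sup>2"
    using inner_const_left[of i "e\<^sup>2" "\<lambda>_. 1"] expect_one[OF i] by (simp add: inner_lev_def)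
  finally show "inner_lev X i g g \<le> e\<^sup>2" .
  define D where "D = down_iter X i k f"
  define E where "E = expect X k f"
  have ED: "expect X i D = E" unfolding D_def E_def by (rule expect_down_iter) fact+
  have Eg: "expect X i g = 0"
  proof -
    have "expect X i g = inner_lev X i g (\<lambda>_. 1)" by (simp add: inner_lev_def)
    also have "\<dots> = expect X i D - E * expect X i (\<lambda>_. 1)"
      unfolding g_def inner_diff_left inner_const_left by (simp add: inner_lev_def D_def E_def)
    finally show ?thesis by (simp add: ED expect_one[OF i])
  qed
  show "inner_lev X i g g \<le> e * \<bar>expect X k f\<bar>" if sign: "local_constant_sign X k i f"
  proof -
    have "inner_lev X i g g = inner_lev X i D g - E * expect X i g"
      unfolding inner_const_left[symmetric] inner_diff_left[symmetric] by (simp add: g_def D_def E_def)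
    also have "\<dots> = inner_lev X i D g" by (simp add: Eg)
    also have "\<dots> \<le> expect X i (\<lambda>s. (e * sgn E) * D s)"
      unfolding inner_lev_def
    proof (rule expect_mono)
      fix s assume s: "s \<in> faces X i"
      have "D s \<noteq> 0 \<Longrightarrow> sgn (D s) = sgn E"
        using sign s down_iter_local_expect[OF s assms(1,2), of f]
        by (auto simp: local_constant_sign_def D_def E_def)
      then have abs: "\<bar>D s\<bar> = sgn E * D s"
        by (cases "D s = 0") (auto simp: abs_sgn)
      have "D s * g s \<le> \<bar>D s\<bar> * \<bar>g s\<bar>" by (metis abs_ge_self abs_mult)
      also have "\<dots> \<le> \<bar>D s\<bar> * e" using g[OF s] by (intro mult_left_mono) auto
      finally show "D s * g s \<le> (e * sgn E) * D s" by (simp add: abs mult_ac)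
    qed
    also have "\<dots> = (e * sgn E) * E"
      using inner_const_left[of i "e * sgn E" D] by (simp add: inner_lev_def ED)
    also have "\<dots> = e * \<bar>E\<bar>" by (simp add: abs_sgn mult_ac)
    finally show ?thesis by (simp add: E_def)
  qed
qed

end

theorem theorem8p7:
  "\<exists>C0 > (0::real). \<exists>C1 > (0::real). \<exists>c :: nat \<Rightarrow> real.
     (\<forall>k. c k \<le> 2 powr (C1 * real k)) \<and>
     (\<forall>(n::nat) (X::wcomplex) (\<gamma>::real) (k::nat) (f :: nat set \<Rightarrow> real)
        (fs :: nat \<Rightarrow> nat set \<Rightarrow> real) (l::nat) (\<epsilon> :: nat \<Rightarrow> real).
        weighted_pure_complex n X \<longrightarrow>
        two_sided_local_expander X \<gamma> \<longrightarrow>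
        k \<le> cdim X \<longrightarrow>
        \<gamma> \<le> 2 powr (- (C0 * real k)) \<longrightarrow>
        HD_decomposition X k f fs \<longrightarrow>
        l \<le> k \<longrightarrow>
        linf_pseudorandom X k l \<epsilon> f \<longrightarrow>
        (\<forall>i\<in>{1..l}.
           \<bar>inner_lev X k f (fs i)\<bar>
             \<le> (real (k choose i) + c k * \<gamma>) * (\<epsilon> i)\<^sup>2 + c k * \<gamma> * (norm_lev X k f)\<^sup>2 \<and>
           (local_constant_sign X k i f \<longrightarrow>
              \<bar>inner_lev X k f (fs i)\<bar>
                \<le> real (k choose i) * \<epsilon> i * \<bar>expect X k f\<bar> + c k * \<gamma> * (norm_lev X k f)\<^sup>2)))"
proof (rule exI[of _ 6], rule conjI, simp, rule exI[of _ 5], rule conjI, simp,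
    rule exI[of _ "\<lambda>k. 2 powr (5 * real k)"], rule conjI, simp, intro allI impI ballI)
  fix n X \<gamma> k f fs l \<epsilon> i
  assume "weighted_pure_complex n X"
    and exp: "two_sided_local_expander X \<gamma>" and k: "k \<le> cdim X"
    and \<gamma>: "\<gamma> \<le> 2 powr (- (6 * real k))" and dec: "HD_decomposition X k f fs"
    and "l \<le> k" and pr: "linf_pseudorandom X k l \<epsilon> f" and "i \<in> {1..l}"
  interpret weighted_complex n X by standard fact
  have i: "1 \<le> i" "i \<le> k" using \<open>l \<le> k\<close> \<open>i \<in> {1..l}\<close> by auto
  have "\<forall>j\<in>{..k}. \<exists>h. h \<in> H_space X j \<and> (\<forall>y\<in>faces X k. fs j y = up_iter X j k h y)"
    using dec by (auto simp: HD_decomposition_def V_space_def)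
  from bchoice[OF this] obtain h where h: "\<And>j. j \<le> k \<Longrightarrow> h j \<in> H_space X j"
    and fs: "\<And>j y. j \<le> k \<Longrightarrow> y \<in> faces X k \<Longrightarrow> fs j y = up_iter X j k (h j) y"
    by auto
  have f: "f y = (\<Sum>j\<le>k. up_iter X j k (h j) y)" if "y \<in> faces X k" for y
    using dec that fs by (simp add: HD_decomposition_def)
  define g where "g = (\<lambda>s. down_iter X i k f s - expect X k f)"
  let ?c = "2 powr (5 * real k) * \<gamma>"
  have "inner_lev X k f (fs i) = inner_lev X k f (up_iter X i k (h i))"
    using fs i by (intro inner_cong) auto
  then have main: "\<bar>inner_lev X k f (fs i)\<bar>
      \<le> real (k choose i) * inner_lev X i g g + ?c * (norm_lev X k f)\<^sup>2"
    using level_projection_bound[OF exp k i h f \<gamma> refl] by (simp add: g_def)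
  have linf: "linf_norm X i (\<lambda>s. down_iter X i k f s - expect X k f) \<le> \<epsilon> i"
    using pr \<open>i \<in> {1..l}\<close> by (simp add: linf_pseudorandom_def)
  note dev = pseudorandom_deviation[OF i(2) k linf, folded g_def]
  have \<gamma>0: "0 \<le> \<gamma>" using exp by (simp add: two_sided_local_expander_def)
  have "real (k choose i) * inner_lev X i g g \<le> real (k choose i) * (\<epsilon> i)\<^sup>2"
    by (intro mult_left_mono dev) simp
  also have "\<dots> \<le> (real (k choose i) + ?c) * (\<epsilon> i)\<^sup>2"
    using \<gamma>0 by (intro mult_right_mono) auto
  finally have first: "\<bar>inner_lev X k f (fs i)\<bar>
      \<le> (real (k choose i) + ?c) * (\<epsilon> i)\<^sup>2 + ?c * (norm_lev X k f)\<^sup>2"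
    using main by linarith
  have second: "\<bar>inner_lev X k f (fs i)\<bar>
      \<le> real (k choose i) * \<epsilon> i * \<bar>expect X k f\<bar> + ?c * (norm_lev X k f)\<^sup>2"
    if "local_constant_sign X k i f"
  proof -
    have "real (k choose i) * inner_lev X i g g \<le> real (k choose i) * (\<epsilon> i * \<bar>expect X k f\<bar>)"
      by (intro mult_left_mono dev that) simp
    then show ?thesis using main by (simp only: mult.assoc)
  qed
  show "\<bar>inner_lev X k f (fs i)\<bar>
          \<le> (real (k choose i) + ?c) * (\<epsilon> i)\<^sup>2 + ?c * (norm_lev X k f)\<^sup>2 \<and>
        (local_constant_sign X k i f \<longrightarrow>
           \<bar>inner_lev X k f (fs i)\<bar>
             \<le> real (k choose i) * \<epsilon> i * \<bar>expect X k f\<bar> + ?c * (norm_lev X k f)\<^sup>2)"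
    using first second by blast
qed

end
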